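(* Let $k\ge2$ and let $Y_N\subseteq\mathbb{R}^k$ be the finite nondominated set of a multi-objective integer optimization problem (not necessarily in general position), and let $\mathcal{T}(Y_N)$ be its set of true combinations. Then: (i) For each $\mathcal{Z}\in\mathcal{T}(Y_N)$ with $\mathcal{Z}\ne(d^1,\dots,d^{k-1})$, it holds that $$\bigl|\{\mathcal{Y}\in\mathcal{T}(Y_N):\ \exists\,\ell\in[k-1]\text{ with }\mathcal{Z}=\mathrm{scion}^{\ell}(\mathcal{Y})\}\bigr|=1.$$ (ii) For each $y\in Y_N$ there exists exactly one true combination $\mathcal{Y}(y)\in\mathcal{T}(Y_N)$ such that $y$ is optimal for $\Pi(\varepsilon(\mathcal{Y}(y)))$ and $\mathcal{Y}(y)^i_{-[i]}\leq y_{-[i]}$ for all $i\in[k-1]$. (iii) $|\mathcal{T}(Y_N)|\in\mathcal{O}(|Y_N|^{\lfloor k/2\rfloor})$.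
   Context: Setting: $\min f(x)=(f_1(x),\dots,f_k(x))$, $x\in X\subseteq\mathbb{Z}^n$, $k\ge2$, $Y=f(X)\subseteq\mathbb{R}^k$. For vectors $a,b$: $a\leq b$ means $a_i\le b_i$ for all $i$ and $a\neq b$; $a<b$ means $a_i<b_i$ for all $i$. $Y_N=\{y\in Y:\nexists\,\bar y\in Y,\ \bar y\leq y\}$, assumed finite. $[m]=\{1,\dots,m\}$, $y_{-k}=(y_1,\dots,y_{k-1})$, $y_{-[i]}=(y_{i+1},\dots,y_k)$. $<_{\mathrm{lex}}$ is the lexicographic order. Constants: fix $\delta>0$ smaller than all nonzero values $|y_i-\bar y_i|$ with $y,\bar y\in Y_N$, $i\in[k]$, and fix $M>\delta+\max\{|y_i|:y\in Y_N,i\in[k]\}$. Dummy images: for $t\in[k-1]$, $d^t\in\mathbb{R}^k$ has $d^t_t=M$ and $d^t_i=-M$ for $i\ne t$ ($M$ represents $\infty$). The following is defined for a finite set $N\subseteq\mathbb{R}^k$ of pairwise nondominated vectors with coordinates in $(-M,M)$ (used for $N=Y_N$ and $N=\Phi(Y_N)$). For $\varepsilon\in\mathbb{R}^{k-1}$, $y\in N$ is feasible for $\Pi(\varepsilon)$ if $y_{-k}<\varepsilon$, and optimal for $\Pi(\varepsilon)$ if moreover $(y_k,\dots,y_1)$ is lexicographically smallest among feasible elements of $N$ (this is the lexicographic epsilon-constraint scalarization: lex-minimize $(f_k,\dots,f_1)$ subject to $f_{-k}<\varepsilon$). The epsilon-component of $y\in N$ is $E(y)=\{\varepsilon\in\mathbb{R}^{k-1}: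 y\text{ is optimal for }\Pi(\varepsilon)\}$; for a dummy, $E(d^t)$ is the set of $\varepsilon$ such that $d^t_{-k}<\varepsilon$ and $(d^t_k,\dots,d^t_1)$ is lexicographically smallest among all $y\in N\cup\{d^1,\dots,d^{k-1}\}$ with $y_{-k}<\varepsilon$. Put $E^i(y)=\{\varepsilon\in\mathrm{cl}(E(y)):\varepsilon_i=y_i\}$. A viable combination of $N$ is a tuple $\mathcal{Y}=(\mathcal{Y}^1,\dots,\mathcal{Y}^{k-1})$ of elements of $N\cup\{d^1,\dots,d^{k-1}\}$ with $\bigcap_{i=1}^{k-1}E^i(\mathcal{Y}^i)\ne\emptyset$; its viable parameter is $\varepsilon(\mathcal{Y})=(\mathcal{Y}^1_1,\dots,\mathcal{Y}^{k-1}_{k-1})$. $\mathcal{V}(N)$ is the set of viable combinations of $N$. Perturbation: let $K=|Y_N|$ and order $Y_N=\{y^1,\dots,y^K\}$ so that $(y^1_k,\dots,y^1_1)<_{\mathrm{lex}}\dots<_{\mathrm{lex}}(y^K_k,\dots,y^K_1)$. Define $\Phi(y^i)_j=y^i_j+\frac{i\delta}{K+1}$ if there is $s<i$ with $y^s_j=y^i_j$, and $\Phi(y^i)_j=y^i_j$ otherwise; $\Phi(d^t)=d^t$; $\Phi(\mathcal{Y})=(\Phi(\mathcal{Y}^1),\dots,\Phi(\mathcal{Y}^{k-1}))$. A true combination of $Y_N$ is a viable combination $\mathcal{Y}$ of $Y_N$ such that $\Phi(\mathcal{Y})$ is a viable combination of $\Phi(Y_N)$; $\mathcal{T}(Y_N)$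 is the set of true combinations. Scions: let $\mathcal{Y}\in\mathcal{T}(Y_N)$ be such that $\Pi(\varepsilon(\mathcal{Y}))$ has an optimal image $y^*\in Y_N$. For $\ell\in[k-1]$ such that $y^*_\ell\ge\mathcal{Y}^i_\ell$ for all $i\in[k-1]\setminus\{\ell\}$, the $\ell$-th scion is $\mathrm{scion}^\ell(\mathcal{Y})=(\mathcal{Y}^1,\dots,\mathcal{Y}^{\ell-1},y^*,\mathcal{Y}^{\ell+1},\dots,\mathcal{Y}^{k-1})$; otherwise the $\ell$-th scion does not exist.
   Formalization: Viable combinations are additionally required to have pairwise distinct components; without this (i) fails for every k≥3 (for k=3, Y_N={y}, the tuple (y,y) is true but is no scion). In (iii) Y_N is assumed nonempty. *)

theory Defs
  imports "HOL-Analysis.Analysis"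
begin

(* Points of R^m are functions in {1..m} \<rightarrow>\<^sub>E UNIV, points of Z^n likewise with values
   in int; coordinates are numbered from 1. *)

definition vle :: "nat set \<Rightarrow> (nat \<Rightarrow> real) \<Rightarrow> (nat \<Rightarrow> real) \<Rightarrow> bool" where
  "vle I a b \<longleftrightarrow> (\<forall>i\<in>I. a i \<le> b i) \<and> (\<exists>i\<in>I. a i \<noteq> b i)"

definition vless :: "nat set \<Rightarrow> (nat \<Rightarrow> real) \<Rightarrow> (nat \<Rightarrow> real) \<Rightarrow> bool" where
  "vless I a b \<longleftrightarrow> (\<forall>i\<in>I. a i < b i)"

(* (a_k, ..., a_1) <_lex (b_k, ..., b_1) *)
definition revlex_less :: "nat \<Rightarrow> (nat \<Rightarrow> real) \<Rightarrow> (nat \<Rightarrow> real) \<Rightarrow> bool" where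
  "revlex_less k a b \<longleftrightarrow>
     ord_class.lexordp (map a (rev [1..<Suc k])) (map b (rev [1..<Suc k]))"

definition nondominated :: "nat \<Rightarrow> (nat \<Rightarrow> real) set \<Rightarrow> (nat \<Rightarrow> real) set" where
  "nondominated k Y = {y \<in> Y. \<not> (\<exists>z\<in>Y. vle {1..k} z y)}"

definition integer_problem ::
  "nat \<Rightarrow> nat \<Rightarrow> (nat \<Rightarrow> int) set \<Rightarrow> ((nat \<Rightarrow> int) \<Rightarrow> (nat \<Rightarrow> real)) \<Rightarrow> bool" where
  "integer_problem k n X f \<longleftrightarrow>
     X \<subseteq> ({1..n} \<rightarrow>\<^sub>E UNIV) \<and> f \<in> X \<rightarrow> ({1..k} \<rightarrow>\<^sub>E UNIV) \<and>
     finite (nondominated k (f ` X))"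

(* The conjunct \<delta> < M is implied by the last one unless N is empty. *)
definition admissible_constants ::
  "nat \<Rightarrow> (nat \<Rightarrow> real) set \<Rightarrow> real \<Rightarrow> real \<Rightarrow> bool" where
  "admissible_constants k N \<delta> M \<longleftrightarrow>
     0 < \<delta> \<and>
     (\<forall>y\<in>N. \<forall>z\<in>N. \<forall>i\<in>{1..k}. y i \<noteq> z i \<longrightarrow> \<delta> < \<bar>y i - z i\<bar>) \<and>
     \<delta> < M \<and> (\<forall>y\<in>N. \<forall>i\<in>{1..k}. \<delta> + \<bar>y i\<bar> < M)"

definition dummy :: "nat \<Rightarrow> real \<Rightarrow> nat \<Rightarrow> (nat \<Rightarrow> real)" where
  "dummy k M t = (\<lambda>i\<in>{1..k}. if i = t then M else - M)"

definition dummies :: "nat \<Rightarrow> real \<Rightarrow> (nat \<Rightarrow> real) set" where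
  "dummies k M = dummy k M ` {1..k-1}"

definition feasible :: "nat \<Rightarrow> (nat \<Rightarrow> real) \<Rightarrow> (nat \<Rightarrow> real) \<Rightarrow> bool" where
  "feasible k \<epsilon> y \<longleftrightarrow> vless {1..k-1} y \<epsilon>"

definition optimal ::
  "nat \<Rightarrow> (nat \<Rightarrow> real) set \<Rightarrow> (nat \<Rightarrow> real) \<Rightarrow> (nat \<Rightarrow> real) \<Rightarrow> bool" where
  "optimal k S \<epsilon> y \<longleftrightarrow>
     y \<in> S \<and> feasible k \<epsilon> y \<and>
     (\<forall>z\<in>S. feasible k \<epsilon> z \<and> z \<noteq> y \<longrightarrow> revlex_less k y z)"

(* Dummies compete only in the components of dummies. *)
definition eps_component ::
  "nat \<Rightarrow> real \<Rightarrow> (nat \<Rightarrow> real) set \<Rightarrow> (nat \<Rightarrow> real) \<Rightarrow> (nat \<Rightarrow> real) set" where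
  "eps_component k M N y =
     {\<epsilon> \<in> {1..k-1} \<rightarrow>\<^sub>E UNIV. optimal k (if y \<in> N then N else N \<union> dummies k M) \<epsilon> y}"

definition eps_facet ::
  "nat \<Rightarrow> real \<Rightarrow> (nat \<Rightarrow> real) set \<Rightarrow> nat \<Rightarrow> (nat \<Rightarrow> real) \<Rightarrow> (nat \<Rightarrow> real) set" where
  "eps_facet k M N i y =
     {\<epsilon> \<in> product_topology (\<lambda>_. euclideanreal) {1..k-1} closure_of eps_component k M N y.
        \<epsilon> i = y i}"

(* The components of a combination are required to be pairwise distinct. Without this, corners
   of the closed components yield degenerate combinations: for k = 3 and N = {y}, the tuple
   (y, y) would be viable with parameter (y_1, y_2), and (d^1, d^1) with parameter (M, -M),
   although neither is a scion of any combination. *)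
definition viable ::
  "nat \<Rightarrow> real \<Rightarrow> (nat \<Rightarrow> real) set \<Rightarrow> (nat \<Rightarrow> nat \<Rightarrow> real) set" where
  "viable k M N =
     {\<Y> \<in> {1..k-1} \<rightarrow>\<^sub>E (N \<union> dummies k M).
        inj_on \<Y> {1..k-1} \<and> (\<Inter>i\<in>{1..k-1}. eps_facet k M N i (\<Y> i)) \<noteq> {}}"

definition viable_parameter :: "nat \<Rightarrow> (nat \<Rightarrow> nat \<Rightarrow> real) \<Rightarrow> (nat \<Rightarrow> real)" where
  "viable_parameter k \<Y> = (\<lambda>i\<in>{1..k-1}. \<Y> i i)"

(* The position of y in N ordered increasingly by revlex_less, counted from 1. *)
definition lex_rank :: "nat \<Rightarrow> (nat \<Rightarrow> real) set \<Rightarrow> (nat \<Rightarrow> real) \<Rightarrow> nat" where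
  "lex_rank k N y = Suc (card {s \<in> N. revlex_less k s y})"

definition perturb ::
  "nat \<Rightarrow> real \<Rightarrow> (nat \<Rightarrow> real) set \<Rightarrow> (nat \<Rightarrow> real) \<Rightarrow> (nat \<Rightarrow> real)" where
  "perturb k \<delta> N y =
     (if y \<in> N
      then (\<lambda>j\<in>{1..k}.
              if \<exists>s\<in>N. revlex_less k s y \<and> s j = y j
              then y j + real (lex_rank k N y) * \<delta> / (real (card N) + 1)
              else y j)
      else y)"

definition true_combinations ::
  "nat \<Rightarrow> real \<Rightarrow> real \<Rightarrow> (nat \<Rightarrow> real) set \<Rightarrow> (nat \<Rightarrow> nat \<Rightarrow> real) set" where
  "true_combinations k \<delta> M N =
     {\<Y> \<in> viable k M N.
        (\<lambda>i\<in>{1..k-1}. perturb k \<delta> N (\<Y> i)) \<in> viable k M (perturb k \<delta> N ` N)}"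

(* is_scion k N l \<Y> \<Z>: the l-th scion of \<Y> exists and equals \<Z>. *)
definition is_scion ::
  "nat \<Rightarrow> (nat \<Rightarrow> real) set \<Rightarrow> nat \<Rightarrow> (nat \<Rightarrow> nat \<Rightarrow> real) \<Rightarrow> (nat \<Rightarrow> nat \<Rightarrow> real) \<Rightarrow> bool" where
  "is_scion k N l \<Y> \<Z> \<longleftrightarrow>
     (\<exists>y. optimal k N (viable_parameter k \<Y>) y \<and>
          (\<forall>i\<in>{1..k-1} - {l}. \<Y> i l \<le> y l) \<and>
          \<Z> = \<Y>(l := y))"

end

theory Submission
  imports Defs
begin

text \<open>
  After the perturbation all coordinates are distinct, and the true combinations are exactly the
  tuples \<open>Y\<close> with \<open>Y i\<close> strictly below \<open>Y j\<close> in coordinate \<open>j\<close> for \<open>i \<noteq> j\<close>, such that no point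
  strictly below the parameter in the first \<open>k - 1\<close> coordinates precedes some \<open>Y i\<close> in
  coordinate \<open>k\<close>.  The parent of \<open>Z\<close> replaces the component \<open>Z l\<close> with the largest \<open>k\<close>-th
  coordinate by the next larger admissible point in coordinate \<open>l\<close>.  The combination belonging to
  \<open>y\<close> is built greedily, coordinate by coordinate.

  For the bound, add the optimal image (or a dummy) as a \<open>k\<close>-th component and let \<open>\<pi> j < j\<close> be the
  position whose point has the largest \<open>j\<close>-th coordinate among the positions before \<open>j\<close>.  The map
  \<open>\<pi>\<close> is a tree on \<open>{1..k}\<close>; one of its two colour classes has at most \<open>k div 2\<close> elements,
  and \<open>\<pi>\<close> together with the points at the positions of that class determines the tuple.  This
  is a combinatorial form of Seidel's proof of the asymptotic upper bound theorem.
\<close>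

section \<open>Extrema over finite sets and two-colourings of trees\<close>

lemma ex_min_on:
  fixes f :: "'b \<Rightarrow> real"
  assumes "finite S" "S \<noteq> {}"
  shows "\<exists>w\<in>S. \<forall>v\<in>S. f w \<le> f v"
  using ex_is_arg_min_if_finite[OF assms, of f] unfolding is_arg_min_linorder by blast

lemma ex_max_on:
  fixes f :: "'b \<Rightarrow> real"
  assumes "finite S" "S \<noteq> {}"
  shows "\<exists>w\<in>S. \<forall>v\<in>S. f v \<le> f w"
  using ex_min_on[OF assms, of "\<lambda>x. - f x"] by simp

text \<open>Since \<open>\<pi> j < j\<close>, the vertices can be coloured in increasing order: each
  new vertex gets the colour opposite to that of its already coloured parent.\<close>

lemma ex_two_colouring:
  fixes \<pi> :: "nat \<Rightarrow> nat"
  assumes "\<And>j. j \<in> {2..n} \<Longrightarrow> \<pi> j < j"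
  shows "\<exists>A\<subseteq>{1..n}. \<forall>j\<in>{2..n}. j \<in> A \<longleftrightarrow> \<pi> j \<notin> A"
  using assms
proof (induction n)
  case 0
  then show ?case by auto
next
  case (Suc n)
  then obtain A where A: "A \<subseteq> {1..n}" "\<forall>j\<in>{2..n}. j \<in> A \<longleftrightarrow> \<pi> j \<notin> A" by fastforce
  define A' where "A' = (if \<pi> (Suc n) \<in> A then A else insert (Suc n) A)"
  have mem: "j \<in> A' \<longleftrightarrow> j \<in> A" if "j \<le> n" for j using that unfolding A'_def by auto
  have "j \<in> A' \<longleftrightarrow> \<pi> j \<notin> A'" if j: "j \<in> {2..Suc n}" for j
  proof -
    have "\<pi> j < j" using Suc.prems j by blast
    then have *: "\<pi> j \<in> A' \<longleftrightarrow> \<pi> j \<in> A" using mem[of "\<pi> j"] j by auto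
    show ?thesis
    proof (cases "j = Suc n")
      case True
      then show ?thesis using * A(1) unfolding A'_def by auto
    next
      case False
      then show ?thesis using * mem[of j] A(2) j by auto
    qed
  qed
  moreover have "A' \<subseteq> {1..Suc n}" using A(1) unfolding A'_def by auto
  ultimately show ?case by blast
qed

section \<open>Points in general position\<close>

text \<open>Points and coordinates are kept apart so that \<open>c\<close> can be instantiated with
  the perturbed coordinates while combinations still consist of the original points. The dummies
  include one for coordinate \<open>k\<close>, which serves the counting.\<close>

locale generic_points =
  fixes k :: nat and M :: real and N :: "'a set" and d :: "nat \<Rightarrow> 'a" and c :: "'a \<Rightarrow> nat \<Rightarrow> real"
  assumes k_ge_2: "k \<ge> 2"
    and finite_N: "finite N"
    and coord_inj: "\<And>x y j. x \<in> N \<Longrightarrow> y \<in> N \<Longrightarrow> j \<in> {1..k} \<Longrightarrow> c x j = c y j \<Longrightarrow> x = y"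
    and coord_gt: "\<And>x j. x \<in> N \<Longrightarrow> j \<in> {1..k} \<Longrightarrow> - M < c x j"
    and coord_lt: "\<And>x j. x \<in> N \<Longrightarrow> j \<in> {1..k} \<Longrightarrow> c x j < M"
    and coord_d_same: "\<And>t. t \<in> {1..k} \<Longrightarrow> c (d t) t = M"
    and coord_d_other: "\<And>t j. t \<in> {1..k} \<Longrightarrow> j \<in> {1..k} \<Longrightarrow> j \<noteq> t \<Longrightarrow> c (d t) j = - M"
    and M_pos: "0 < M"
    and not_dominated: "\<And>x y. x \<in> N \<Longrightarrow> y \<in> N \<Longrightarrow> \<exists>j\<in>{1..k}. c y j \<le> c x j"
begin

definition below :: "(nat \<Rightarrow> 'a) \<Rightarrow> 'a \<Rightarrow> bool" where
  "below Y z \<longleftrightarrow> (\<forall>j\<in>{1..k-1}. c z j < c (Y j) j)"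

text \<open>Position \<open>i\<close> admits only its own dummy \<open>d i\<close>; for viable
  combinations this is forced, see \<open>viable_dummy\<close>.\<close>

definition combs :: "(nat \<Rightarrow> 'a) set" where
  "combs = {Y \<in> (\<Pi>\<^sub>E i\<in>{1..k-1}. insert (d i) N).
     (\<forall>i\<in>{1..k-1}. \<forall>j\<in>{1..k-1}. i \<noteq> j \<longrightarrow> c (Y i) j < c (Y j) j) \<and>
     (\<forall>z\<in>N. below Y z \<longrightarrow> (\<forall>i\<in>{1..k-1}. c (Y i) k \<le> c z k))}"

text \<open>Minimizing the last coordinate alone determines the optimum, because distinct points
  differ in it.\<close>

definition opt :: "(nat \<Rightarrow> 'a) \<Rightarrow> 'a \<Rightarrow> bool" where
  "opt Y y \<longleftrightarrow> y \<in> N \<and> below Y y \<and> (\<forall>z\<in>N. below Y z \<longrightarrow> c y k \<le> c z k)"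

lemma coord_ge: "x \<in> insert (d t) N \<Longrightarrow> t \<in> {1..k} \<Longrightarrow> j \<in> {1..k} \<Longrightarrow> - M \<le> c x j"
  using coord_gt[of x j] coord_d_same[of t] coord_d_other[of t j] M_pos
  by (cases "j = t") (auto simp: less_imp_le)

lemma coord_le: "x \<in> insert (d t) N \<Longrightarrow> t \<in> {1..k} \<Longrightarrow> j \<in> {1..k} \<Longrightarrow> c x j \<le> M"
  using coord_lt[of x j] coord_d_same[of t] coord_d_other[of t j] M_pos
  by (cases "j = t") (auto simp: less_imp_le)

lemma coord_inj_insert:
  assumes "x \<in> insert (d j) N" "y \<in> insert (d j) N" "j \<in> {1..k}" "c x j = c y j"
  shows "x = y"
  using assms coord_inj coord_lt coord_d_same by (metis insert_iff less_irrefl)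

lemma combs_PiE: "Y \<in> combs \<Longrightarrow> Y \<in> (\<Pi>\<^sub>E i\<in>{1..k-1}. insert (d i) N)"
  unfolding combs_def by blast

lemma combs_mem: "Y \<in> combs \<Longrightarrow> i \<in> {1..k-1} \<Longrightarrow> Y i \<in> insert (d i) N"
  using combs_PiE PiE_mem by metis

lemma combs_ext: "Y \<in> combs \<Longrightarrow> Y \<in> extensional {1..k-1}"
  using combs_PiE unfolding PiE_def by blast

lemma combs_less:
  "Y \<in> combs \<Longrightarrow> i \<in> {1..k-1} \<Longrightarrow> j \<in> {1..k-1} \<Longrightarrow> i \<noteq> j \<Longrightarrow> c (Y i) j < c (Y j) j"
  unfolding combs_def by blast

lemma combs_last_le:
  "Y \<in> combs \<Longrightarrow> z \<in> N \<Longrightarrow> below Y z \<Longrightarrow> i \<in> {1..k-1} \<Longrightarrow> c (Y i) k \<le> c z k"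
  unfolding combs_def by blast

text \<open>Coordinate \<open>i\<close> separates \<open>z\<close> from \<open>Y i\<close>, so the
  two differ and general position makes the weak inequality strict; a dummy has last coordinate
  \<open>- M\<close>.\<close>

lemma combs_last_less:
  assumes "Y \<in> combs" "z \<in> N" "below Y z" "i \<in> {1..k-1}"
  shows "c (Y i) k < c z k"
proof -
  have "c (Y i) i \<noteq> c z i" using assms unfolding below_def by (metis less_irrefl)
  then have "Y i \<noteq> z" by auto
  moreover have "c (Y i) k \<le> c z k" by (rule combs_last_le[OF assms])
  moreover have "k \<in> {1..k}" "k \<noteq> i" "i \<in> {1..k}" using k_ge_2 assms(4) by auto
  ultimately show ?thesis
    using combs_mem[OF assms(1,4)] coord_inj[of "Y i" z k] coord_gt[of z k] coord_d_other[of i k] assms(2)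
    by (smt (verit) insert_iff)
qed

section \<open>Existence and uniqueness of the parent\<close>

text \<open>The set \<open>S\<close> of candidates contains \<open>d l\<close>, hence is nonempty,
  and \<open>w\<close> is the candidate nearest to \<open>Z l\<close> in coordinate
  \<open>l\<close>. Minimality keeps every point that precedes \<open>Z l\<close> in the last
  coordinate infeasible for the new tuple, so \<open>Z l\<close> becomes optimal.\<close>

lemma ex_parent_point:
  assumes Z: "Z \<in> combs" and l: "l \<in> {1..k-1}" and y: "Z l \<in> N"
    and last: "\<And>i. i \<in> {1..k-1} - {l} \<Longrightarrow> c (Z i) k < c (Z l) k"
  shows "\<exists>w. Z(l := w) \<in> combs \<and> opt (Z(l := w)) (Z l)"
proof -
  define S where "S = {w \<in> insert (d l) N. c w k < c (Z l) k \<and> c (Z l) l < c w l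
    \<and> (\<forall>j\<in>{1..k-1} - {l}. c w j < c (Z j) j)}"
  have lk: "l \<in> {1..k}" "k \<in> {1..k}" "k \<noteq> l" using l by auto
  have "d l \<in> S"
  proof -
    have "c (d l) j < c (Z j) j" if "j \<in> {1..k-1} - {l}" for j
    proof -
      have j: "j \<in> {1..k}" "j \<noteq> l" "j \<in> {1..k-1}" using that by auto
      show ?thesis
        using coord_d_other[OF lk(1) j(1,2)] coord_gt[OF y j(1)] combs_less[OF Z l j(3)] j(2) by simp
    qed
    then show ?thesis unfolding S_def
      using coord_d_other[of l k] coord_d_same[of l] lk coord_gt[OF y, of k] coord_lt[OF y, of l] by auto
  qed
  moreover have "finite S" unfolding S_def using finite_N by auto
  ultimately obtain w where w: "w \<in> S" and wmin: "\<And>v. v \<in> S \<Longrightarrow> c w l \<le> c v l"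
    using ex_min_on[of S "\<lambda>v. c v l"] by blast
  let ?Y = "Z(l := w)"
  have no: "c (Z l) k \<le> c z k" if z: "z \<in> N" "below ?Y z" for z
  proof (rule ccontr)
    assume "\<not> ?thesis"
    then have zk: "c z k < c (Z l) k" by simp
    have zY: "c z j < c (?Y j) j" if "j \<in> {1..k-1}" for j
      using z(2) that unfolding below_def by blast
    have zl: "c z l < c w l" using zY[OF l] by simp
    have zj: "c z j < c (Z j) j" if "j \<in> {1..k-1} - {l}" for j using zY[of j] that by simp
    \<comment> \<open>On the near side of \<open>Z l\<close> the point \<open>z\<close> would be
      feasible for \<open>Z\<close> itself; on the far side it would be a candidate nearer than
      \<open>w\<close>.\<close>
    have "\<not> c z l < c (Z l) l"
    proof
      assume "c z l < c (Z l) l"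
      then have "below Z z" unfolding below_def using zj by blast
      then show False using combs_last_le[OF Z z(1) _ l] zk by simp
    qed
    moreover have "c z l \<noteq> c (Z l) l" using coord_inj[OF z(1) y lk(1)] zk by auto
    ultimately have "z \<in> S" unfolding S_def using z(1) zk zj by auto
    then show False using wmin[of z] zl by simp
  qed
  have wS: "w \<in> insert (d l) N" "c w k < c (Z l) k" "c (Z l) l < c w l"
    "\<And>j. j \<in> {1..k-1} - {l} \<Longrightarrow> c w j < c (Z j) j" using w unfolding S_def by auto
  have "?Y \<in> combs"
    unfolding combs_def
  proof (intro CollectI conjI ballI impI)
    show "?Y \<in> (\<Pi>\<^sub>E i\<in>{1..k-1}. insert (d i) N)"
    proof (rule PiE_I)
      show "?Y i \<in> insert (d i) N" if "i \<in> {1..k-1}" for i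
        using combs_mem[OF Z that] wS(1) by simp
      show "?Y i = undefined" if "i \<notin> {1..k-1}" for i
        using combs_ext[OF Z] that l unfolding extensional_def by auto
    qed
  next
    fix i j assume ij: "i \<in> {1..k-1}" "j \<in> {1..k-1}" "i \<noteq> j"
    then show "c (?Y i) j < c (?Y j) j"
      using combs_less[OF Z ij] wS(3,4) by auto
  next
    fix z i assume "z \<in> N" "below ?Y z" "i \<in> {1..k-1}"
    then show "c (?Y i) k \<le> c z k" using no[of z] wS(2) last[of i] by auto
  qed
  moreover have "opt ?Y (Z l)"
    unfolding opt_def using y no wS(3) combs_less[OF Z l] by (auto simp: below_def)
  ultimately show ?thesis by blast
qed

text \<open>If \<open>w'\<close> were the nearer of the two, it would be feasible for the tuple with
  \<open>w\<close> and precede the optimal \<open>y\<close> in the last coordinate. Exchanging the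
  roles of \<open>w\<close> and \<open>w'\<close> gives equality.\<close>

lemma parent_point_unique:
  assumes Y: "Z(l := w) \<in> combs" "opt (Z(l := w)) y"
    and Y': "Z(l := w') \<in> combs" "opt (Z(l := w')) y" and l: "l \<in> {1..k-1}"
  shows "c w l \<le> c w' l"
proof (rule ccontr)
  assume "\<not> ?thesis"
  then have less: "c w' l < c w l" by simp
  have lk: "l \<in> {1..k}" using l by auto
  have w: "w \<in> insert (d l) N" and w': "w' \<in> insert (d l) N"
    using combs_mem[OF Y(1) l] combs_mem[OF Y'(1) l] by auto
  have "w' \<in> N" using w' less coord_le[OF w lk lk] coord_d_same[OF lk] by auto
  moreover have "below (Z(l := w)) w'"
    unfolding below_def using less combs_less[OF Y'(1) l] by auto
  moreover have "c w' k < c y k"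
    using combs_last_less[OF Y'(1) _ _ l, of y] Y'(2) unfolding opt_def by simp
  ultimately show False using Y(2) unfolding opt_def by (meson not_le)
qed

text \<open>An optimal image has a larger last coordinate than every component of its combination.
  The replaced position can therefore be recognized in \<open>Z\<close>: it is the one whose last
  coordinate is largest.\<close>

theorem ex1_parent:
  assumes Z: "Z \<in> combs" and ne: "Z \<noteq> (\<lambda>t\<in>{1..k-1}. d t)"
  shows "\<exists>!Y. Y \<in> combs \<and> (\<exists>l\<in>{1..k-1}. \<exists>y. opt Y y \<and>
           (\<forall>i\<in>{1..k-1} - {l}. c (Y i) l < c y l) \<and> Z = Y(l := y))"
proof -
  note Zext = combs_ext[OF Z]
  obtain i0 where i0: "i0 \<in> {1..k-1}" "Z i0 \<noteq> d i0"
    using ne extensionalityI[OF Zext restrict_extensional] by fastforce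
  then have i0N: "Z i0 \<in> N" using combs_mem[OF Z i0(1)] by auto
  obtain l where l: "l \<in> {1..k-1}" and lmax: "\<And>i. i \<in> {1..k-1} \<Longrightarrow> c (Z i) k \<le> c (Z l) k"
    using ex_max_on[of "{1..k-1}" "\<lambda>i. c (Z i) k"] i0(1) by auto
  have lk: "l \<in> {1..k}" "k \<in> {1..k}" "k \<noteq> l" using l by auto
  \<comment> \<open>As \<open>Z\<close> contains a point of \<open>N\<close>, the maximum is
    attained at a point of \<open>N\<close> and not at a dummy.\<close>
  have "- M < c (Z l) k" using lmax[OF i0(1)] coord_gt[OF i0N lk(2)] by simp
  then have y: "Z l \<in> N" using combs_mem[OF Z l] coord_d_other[of l k] lk by auto
  have last: "c (Z i) k < c (Z l) k" if i: "i \<in> {1..k-1} - {l}" for i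
  proof (cases "Z i \<in> N")
    case True
    have "Z i \<noteq> Z l" using combs_less[OF Z, of i l] i l by auto
    then have "c (Z i) k \<noteq> c (Z l) k" using coord_inj[OF True y lk(2)] by blast
    then show ?thesis using lmax[of i] i by simp
  next
    case False
    then have "Z i = d i" using combs_mem[OF Z, of i] i by auto
    moreover have "i \<in> {1..k}" "k \<noteq> i" using i by auto
    ultimately show ?thesis using coord_d_other[of i k] lk(2) coord_gt[OF y lk(2)] by auto
  qed
  obtain w where w: "Z(l := w) \<in> combs" "opt (Z(l := w)) (Z l)"
    using ex_parent_point[OF Z l y last] by blast
  show ?thesis
  proof (rule ex1I[of _ "Z(l := w)"])
    show "Z(l := w) \<in> combs \<and> (\<exists>l'\<in>{1..k-1}. \<exists>y. opt (Z(l := w)) y \<and>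
           (\<forall>i\<in>{1..k-1} - {l'}. c ((Z(l := w)) i) l' < c y l') \<and> Z = (Z(l := w))(l' := y))"
      using w l combs_less[OF Z _ l] by (intro conjI bexI[of _ l] exI[of _ "Z l"]) auto
  next
    fix Y assume "Y \<in> combs \<and> (\<exists>l\<in>{1..k-1}. \<exists>y. opt Y y \<and>
           (\<forall>i\<in>{1..k-1} - {l}. c (Y i) l < c y l) \<and> Z = Y(l := y))"
    then obtain l' y' where Y: "Y \<in> combs" and l': "l' \<in> {1..k-1}" and oy: "opt Y y'"
      and Zeq: "Z = Y(l' := y')" by blast
    have yless: "c (Y i) k < c y' k" if "i \<in> {1..k-1}" for i
      using combs_last_less[OF Y _ _ that] oy unfolding opt_def by blast
    \<comment> \<open>Otherwise \<open>Z l = Y l\<close> would lie strictly below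
      \<open>y' = Z l'\<close> in the last coordinate, against the choice of
      \<open>l\<close>.\<close>
    have "l' = l"
    proof (rule ccontr)
      assume "l' \<noteq> l"
      then show False using yless[OF l] lmax[OF l'] Zeq by auto
    qed
    then have Zl: "Z l = y'" and Yeq: "Y = Z(l := Y l)" using Zeq by auto
    have Y': "Z(l := Y l) \<in> combs" "opt (Z(l := Y l)) (Z l)" using Y oy Zl Yeq by simp_all
    have "c (Y l) l = c w l"
      using parent_point_unique[OF w Y' l] parent_point_unique[OF Y' w l] by simp
    then have "Y l = w"
      using coord_inj_insert[OF combs_mem[OF Y l] _ lk(1)] combs_mem[OF w(1) l] by auto
    then show "Y = Z(l := w)" using Yeq by simp
  qed
qed

section \<open>The combination belonging to a point\<close>

text \<open>The candidates for position \<open>i\<close> depend only on the components at earlier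
  positions, so positions can be filled in increasing order, each time with the candidate nearest to
  \<open>y\<close> in coordinate \<open>i\<close>; \<open>d i\<close> is always a candidate.\<close>

lemma ex_greedy_tuple:
  assumes y: "y \<in> N"
  defines "S \<equiv> \<lambda>Y i. {w \<in> insert (d i) N. c w k < c y k \<and> c y i < c w i \<and>
    (\<forall>j\<in>{i+1..k-1}. c w j < c y j) \<and> (\<forall>j\<in>{1..<i}. c w j < c (Y j) j)}"
  shows "m \<le> k - 1 \<Longrightarrow> \<exists>Y. \<forall>i\<in>{1..m}. Y i \<in> S Y i \<and> (\<forall>w\<in>S Y i. c (Y i) i \<le> c w i)"
proof (induction m)
  case 0
  then show ?case by auto
next
  case (Suc m)
  then obtain Y where Y: "\<forall>i\<in>{1..m}. Y i \<in> S Y i \<and> (\<forall>w\<in>S Y i. c (Y i) i \<le> c w i)" by auto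
  let ?i = "Suc m"
  have ik: "?i \<in> {1..k}" "k \<in> {1..k}" "k \<noteq> ?i" using Suc.prems k_ge_2 by auto
  have "d ?i \<in> S Y ?i"
  proof -
    have "c (d ?i) j < c (Y j) j" if "j \<in> {1..<?i}" for j
    proof -
      have "c y j < c (Y j) j" using Y that unfolding S_def by auto
      moreover have "j \<in> {1..k}" using that ik by auto
      ultimately show ?thesis using coord_d_other[of ?i j] coord_gt[OF y, of j] that ik by auto
    qed
    moreover have "c (d ?i) j < c y j" if "j \<in> {?i+1..k}" for j
      using that coord_d_other[of ?i j] coord_gt[OF y, of j] ik by auto
    ultimately show ?thesis unfolding S_def
      using coord_d_same[of ?i] ik coord_lt[OF y, of ?i] by auto
  qed
  moreover have "finite (S Y ?i)" unfolding S_def using finite_N by auto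
  ultimately obtain w where w: "w \<in> S Y ?i" and wmin: "\<And>v. v \<in> S Y ?i \<Longrightarrow> c w ?i \<le> c v ?i"
    using ex_min_on[of "S Y ?i" "\<lambda>v. c v ?i"] by blast
  have S_upd: "S (Y(?i := w)) i = S Y i" if "i \<le> ?i" for i
    unfolding S_def using that by (intro Collect_cong) auto
  have "\<forall>i\<in>{1..?i}. (Y(?i := w)) i \<in> S (Y(?i := w)) i \<and>
      (\<forall>v\<in>S (Y(?i := w)) i. c ((Y(?i := w)) i) i \<le> c v i)"
    using Y w wmin S_upd by (auto simp: le_Suc_eq)
  then show ?case by blast
qed

text \<open>If \<open>Y' i\<close> lay strictly nearer than \<open>Y i\<close>, it would be feasible
  for \<open>Y\<close>: before \<open>i\<close> both tuples agree, at \<open>i\<close> by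
  assumption, and after \<open>i\<close> it is below \<open>y\<close>, which is itself feasible. Yet
  it precedes the optimal \<open>y\<close> in the last coordinate.\<close>

lemma leading_comb_coord_le:
  assumes Y: "Y \<in> combs" "opt Y y"
    and Y': "Y' \<in> combs" "opt Y' y" "\<forall>i\<in>{1..k-1}. \<forall>j\<in>{i+1..k-1}. c (Y' i) j < c y j"
    and i: "i \<in> {1..k-1}" and eq: "\<And>j. j \<in> {1..<i} \<Longrightarrow> Y j = Y' j"
  shows "c (Y i) i \<le> c (Y' i) i"
proof (rule ccontr)
  assume "\<not> ?thesis"
  then have less: "c (Y' i) i < c (Y i) i" by simp
  have ik: "i \<in> {1..k}" using i by auto
  have "Y' i \<in> N"
    using combs_mem[OF Y'(1) i] less coord_le[OF combs_mem[OF Y(1) i] ik ik] coord_d_same[OF ik] by auto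
  moreover have "below Y (Y' i)"
    unfolding below_def
  proof
    fix j assume j: "j \<in> {1..k-1}"
    consider "j < i" | "j = i" | "j > i" by linarith
    then show "c (Y' i) j < c (Y j) j"
    proof cases
      case 1
      then show ?thesis using combs_less[OF Y'(1) i j] eq[of j] j by auto
    next
      case 2
      then show ?thesis using less by simp
    next
      case 3
      then have "c (Y' i) j < c y j" using Y'(3) i j by auto
      also have "c y j < c (Y j) j" using Y(2) j unfolding opt_def below_def by auto
      finally show ?thesis .
    qed
  qed
  moreover have "c (Y' i) k < c y k"
    using combs_last_less[OF Y'(1) _ _ i] Y'(2) unfolding opt_def by blast
  ultimately show False using Y(2) unfolding opt_def by (meson not_le)
qed

theorem ex1_leading_comb:
  assumes y: "y \<in> N"
  shows "\<exists>!Y. Y \<in> combs \<and> opt Y y \<and> (\<forall>i\<in>{1..k-1}. \<forall>j\<in>{i+1..k-1}. c (Y i) j < c y j)"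
proof (rule ex_ex1I)
  define S where "S = (\<lambda>Y i. {w \<in> insert (d i) N. c w k < c y k \<and> c y i < c w i \<and>
    (\<forall>j\<in>{i+1..k-1}. c w j < c y j) \<and> (\<forall>j\<in>{1..<i}. c w j < c (Y j) j)})"
  obtain Y0 where Y0: "\<forall>i\<in>{1..k-1}. Y0 i \<in> S Y0 i \<and> (\<forall>w\<in>S Y0 i. c (Y0 i) i \<le> c w i)"
    using ex_greedy_tuple[OF y, of "k-1"] unfolding S_def by auto
  define Y where "Y = restrict Y0 {1..k-1}"
  have S_Y: "S Y i = S Y0 i" if "i \<in> {1..k-1}" for i
    unfolding S_def Y_def using that by (intro Collect_cong) auto
  have Ymem: "Y i \<in> S Y i" and Ymin: "\<And>w. w \<in> S Y i \<Longrightarrow> c (Y i) i \<le> c w i" if "i \<in> {1..k-1}" for i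
    using Y0 S_Y that unfolding Y_def by auto
  have less_y: "c (Y i) j < c y j" if "i \<in> {1..k-1}" "j \<in> {i+1..k-1}" for i j
    using Ymem[OF that(1)] that(2) unfolding S_def by auto
  have y_less: "c y i < c (Y i) i" if "i \<in> {1..k-1}" for i
    using Ymem[OF that] unfolding S_def by auto
  have no: "c y k \<le> c z k" if z: "z \<in> N" "below Y z" for z
  proof (rule ccontr)
    assume "\<not> ?thesis"
    then have zk: "c z k < c y k" by simp
    then have ne: "c z j \<noteq> c y j" if "j \<in> {1..k}" for j using coord_inj[OF z(1) y that] by auto
    \<comment> \<open>A feasible \<open>z\<close> preceding \<open>y\<close> cannot dominate it, so
      it exceeds \<open>y\<close> in some coordinate below \<open>k\<close>. At the largest such
      coordinate \<open>i\<close> it is a candidate for position \<open>i\<close>, nearer than the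
      minimal choice \<open>Y i\<close>.\<close>
    define I where "I = {j \<in> {1..k-1}. c y j < c z j}"
    obtain j where j: "j \<in> {1..k}" "c y j \<le> c z j" using not_dominated[OF z(1) y] by blast
    then have "c y j < c z j" using ne[of j] by simp
    moreover have "j \<in> {1..k-1}" using j zk by (cases "j = k") auto
    ultimately have I: "I \<noteq> {}" "finite I" unfolding I_def by auto
    define i where "i = Max I"
    have iI: "i \<in> I" and imax: "\<And>j. j \<in> I \<Longrightarrow> j \<le> i" unfolding i_def using I by auto
    have "c z j < c y j" if "j \<in> {i+1..k-1}" for j
    proof -
      have j: "j \<in> {1..k}" "j \<in> {1..k-1}" "\<not> j \<le> i" using that by auto
      then have "\<not> c y j < c z j" using imax[of j] unfolding I_def by blast
      then show ?thesis using ne[OF j(1)] by simp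
    qed
    then have "z \<in> S Y i" unfolding S_def using z zk iI unfolding I_def below_def by auto
    then have "c (Y i) i \<le> c z i" using Ymin[of i z] iI unfolding I_def by blast
    moreover have "c z i < c (Y i) i" using iI z(2) unfolding I_def below_def by blast
    ultimately show False by simp
  qed
  have opt: "opt Y y" unfolding opt_def below_def using y y_less no by (auto simp: below_def)
  have "Y \<in> combs"
    unfolding combs_def
  proof (intro CollectI conjI ballI impI)
    show "Y \<in> (\<Pi>\<^sub>E i\<in>{1..k-1}. insert (d i) N)"
      using Ymem unfolding S_def by (auto simp: Y_def)
  next
    fix i j assume ij: "i \<in> {1..k-1}" "j \<in> {1..k-1}" "i \<noteq> j"
    show "c (Y i) j < c (Y j) j"
    proof (cases "j < i")
      case True
      then show ?thesis using Ymem[OF ij(1)] ij unfolding S_def by auto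
    next
      case False
      then have "c (Y i) j < c y j" using less_y[of i j] ij by auto
      then show ?thesis using y_less[OF ij(2)] by simp
    qed
  next
    fix z i assume "z \<in> N" "below Y z" "i \<in> {1..k-1}"
    then show "c (Y i) k \<le> c z k" using no[of z] Ymem[of i] unfolding S_def by auto
  qed
  then show "\<exists>Y. Y \<in> combs \<and> opt Y y \<and> (\<forall>i\<in>{1..k-1}. \<forall>j\<in>{i+1..k-1}. c (Y i) j < c y j)"
    using opt less_y by blast
next
  fix Y Y'
  assume "Y \<in> combs \<and> opt Y y \<and> (\<forall>i\<in>{1..k-1}. \<forall>j\<in>{i+1..k-1}. c (Y i) j < c y j)"
    and "Y' \<in> combs \<and> opt Y' y \<and> (\<forall>i\<in>{1..k-1}. \<forall>j\<in>{i+1..k-1}. c (Y' i) j < c y j)"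
  then have Y: "Y \<in> combs" "opt Y y" "\<forall>i\<in>{1..k-1}. \<forall>j\<in>{i+1..k-1}. c (Y i) j < c y j"
    and Y': "Y' \<in> combs" "opt Y' y" "\<forall>i\<in>{1..k-1}. \<forall>j\<in>{i+1..k-1}. c (Y' i) j < c y j"
    by auto
  \<comment> \<open>At the first position where the tuples could differ, the comparison lemma
    applies in both directions.\<close>
  have "i \<in> {1..k-1} \<longrightarrow> Y i = Y' i" for i
  proof (induction i rule: less_induct)
    case (less i)
    show ?case
    proof
      assume i: "i \<in> {1..k-1}"
      then have eq: "Y j = Y' j" if "j \<in> {1..<i}" for j using less that by auto
      have "c (Y i) i = c (Y' i) i"
        using leading_comb_coord_le[OF Y(1,2) Y' i eq] leading_comb_coord_le[OF Y'(1,2) Y i eq[symmetric]]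
        by simp
      then show "Y i = Y' i"
        using coord_inj_insert[OF combs_mem[OF Y(1) i] combs_mem[OF Y'(1) i]] i by auto
    qed
  qed
  then show "Y = Y'"
    using extensionalityI[OF combs_ext[OF Y(1)] combs_ext[OF Y'(1)]] by blast
qed

subsection \<open>Counting\<close>

text \<open>This treats all \<open>k\<close> coordinates alike: the open orthant below the corner
  \<open>c (U j) j\<close> contains no point of \<open>N\<close>, and \<open>U i\<close> touches its
  \<open>i\<close>-th facet in the relative interior. Such corners are known as local upper
  bounds.\<close>

definition full_combs :: "(nat \<Rightarrow> 'a) set" where
  "full_combs = {U \<in> (\<Pi>\<^sub>E i\<in>{1..k}. insert (d i) N).
     (\<forall>i\<in>{1..k}. \<forall>j\<in>{1..k}. i \<noteq> j \<longrightarrow> c (U i) j < c (U j) j) \<and>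
     \<not> (\<exists>z\<in>N. \<forall>j\<in>{1..k}. c z j < c (U j) j)}"

lemma full_combs_PiE: "U \<in> full_combs \<Longrightarrow> U \<in> (\<Pi>\<^sub>E i\<in>{1..k}. insert (d i) N)"
  unfolding full_combs_def by blast

lemma full_combs_mem: "U \<in> full_combs \<Longrightarrow> i \<in> {1..k} \<Longrightarrow> U i \<in> insert (d i) N"
  using full_combs_PiE PiE_mem by metis

lemma full_combs_less:
  "U \<in> full_combs \<Longrightarrow> i \<in> {1..k} \<Longrightarrow> j \<in> {1..k} \<Longrightarrow> i \<noteq> j \<Longrightarrow> c (U i) j < c (U j) j"
  unfolding full_combs_def by blast

lemma full_combs_empty:
  "U \<in> full_combs \<Longrightarrow> z \<in> N \<Longrightarrow> \<exists>j\<in>{1..k}. c (U j) j \<le> c z j"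
  unfolding full_combs_def by (force simp: not_less)

lemma upto_k: "j \<in> {1..k} \<longleftrightarrow> j = k \<or> j \<in> {1..k-1}"
  using k_ge_2 by auto

text \<open>The added component is the optimal image, or \<open>d k\<close> if no point is feasible.
  Restriction thus maps \<open>full_combs\<close> onto a superset of \<open>combs\<close>, and it
  suffices to count the former.\<close>

lemma combs_extend:
  assumes Y: "Y \<in> combs"
  shows "\<exists>U\<in>full_combs. Y = restrict U {1..k-1}"
proof -
  have "\<exists>v\<in>insert (d k) N. (\<forall>j\<in>{1..k-1}. c v j < c (Y j) j \<and> c (Y j) k < c v k) \<and>
      (\<forall>z\<in>N. below Y z \<longrightarrow> c v k \<le> c z k)"
  proof (cases "\<exists>z\<in>N. below Y z")
    case True
    then have "finite {z \<in> N. below Y z}" "{z \<in> N. below Y z} \<noteq> {}" using finite_N by auto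
    from ex_min_on[OF this, of "\<lambda>z. c z k"] obtain v
      where "v \<in> {z \<in> N. below Y z}" "\<And>z. z \<in> {z \<in> N. below Y z} \<Longrightarrow> c v k \<le> c z k" by metis
    then have v: "v \<in> N" "below Y v" "\<And>z. z \<in> N \<Longrightarrow> below Y z \<Longrightarrow> c v k \<le> c z k" by auto
    then show ?thesis
      using combs_last_less[OF Y v(1,2)] unfolding below_def by blast
  next
    case False
    have "c (d k) j < c (Y j) j \<and> c (Y j) k < c (d k) k" if "j \<in> {1..k-1}" for j
    proof -
      have j: "j \<in> {1..k}" "k \<in> {1..k}" "j \<noteq> k" using that by auto
      have "c (d k) j = - M" "c (d k) k = M" "c (d j) k = - M" "c (d j) j = M"
        using j coord_d_same coord_d_other by auto
      then show ?thesis
        using combs_mem[OF Y that] coord_gt[of "Y j" j] coord_lt[of "Y j" k] j M_pos by fastforce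
    qed
    then show ?thesis using False by blast
  qed
  then obtain v where v: "v \<in> insert (d k) N"
    and vY: "\<And>j. j \<in> {1..k-1} \<Longrightarrow> c v j < c (Y j) j \<and> c (Y j) k < c v k"
    and vmin: "\<And>z. z \<in> N \<Longrightarrow> below Y z \<Longrightarrow> c v k \<le> c z k" by blast
  let ?U = "Y(k := v)"
  have "?U \<in> full_combs"
    unfolding full_combs_def
  proof (intro CollectI conjI ballI impI notI)
    show "?U \<in> (\<Pi>\<^sub>E i\<in>{1..k}. insert (d i) N)"
    proof (rule PiE_I)
      show "?U i \<in> insert (d i) N" if "i \<in> {1..k}" for i
        using that combs_mem[OF Y, of i] v unfolding upto_k by auto
      show "?U i = undefined" if "i \<notin> {1..k}" for i
        using that combs_ext[OF Y] unfolding upto_k extensional_def by auto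
    qed
  next
    fix i j assume "i \<in> {1..k}" "j \<in> {1..k}" "i \<noteq> j"
    then show "c (?U i) j < c (?U j) j"
      using vY[of i] vY[of j] combs_less[OF Y, of i j] unfolding upto_k by auto
  next
    assume "\<exists>z\<in>N. \<forall>j\<in>{1..k}. c z j < c (?U j) j"
    then obtain z where z: "z \<in> N" and zU: "\<And>j. j \<in> {1..k} \<Longrightarrow> c z j < c (?U j) j" by blast
    have "c z j < c (Y j) j" if "j \<in> {1..k-1}" for j
      using zU[of j] that unfolding upto_k by (auto split: if_splits)
    then have "c v k \<le> c z k" using vmin[OF z] unfolding below_def by blast
    then show False using zU[of k] unfolding upto_k by simp
  qed
  moreover have "Y = restrict ?U {1..k-1}"
    by (rule extensionalityI[OF combs_ext[OF Y] restrict_extensional]) auto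
  ultimately show ?thesis by blast
qed

text \<open>For \<open>j \<notin> B\<close> the point at position \<open>\<pi> j \<in> B\<close> bounds the \<open>j\<close>-th coordinate of all
  points at earlier positions.  If \<open>i\<close> is the first position where two tuples differ, this bound
  puts one of the two points at position \<open>i\<close> strictly below the other tuple.\<close>

lemma full_combs_coord_le:
  assumes U: "U \<in> full_combs" and V: "V \<in> full_combs"
    and i: "i \<in> {1..k}" and before: "\<And>j. j \<in> {1..<i} \<Longrightarrow> U j = V j"
    and B: "\<And>j. j \<in> B \<Longrightarrow> U j = V j" "B \<subseteq> {1..k}"
    and \<pi>: "\<And>j. j \<in> {2..k} - B \<Longrightarrow> \<pi> j \<in> B \<and> \<pi> j \<noteq> j \<and> (\<forall>m\<in>{1..<j}. c (U m) j \<le> c (U (\<pi> j)) j)"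
  shows "c (V i) i \<le> c (U i) i"
proof (rule ccontr)
  assume "\<not> ?thesis"
  then have less: "c (U i) i < c (V i) i" by simp
  have "U i \<in> N"
    using full_combs_mem[OF U i] less coord_le[OF full_combs_mem[OF V i] i i] coord_d_same[OF i] by auto
  then obtain j where j: "j \<in> {1..k}" and le: "c (V j) j \<le> c (U i) j"
    using full_combs_empty[OF V] by blast
  \<comment> \<open>As \<open>V\<close> bounds an empty orthant, \<open>U i\<close> leaves it in
    some coordinate \<open>j\<close>. Only a later \<open>j\<close> outside \<open>B\<close> is not
    immediately contradictory; there the shared component at position \<open>\<pi> j\<close> bounds
    \<open>U i\<close> strictly below \<open>V j\<close>.\<close>
  consider "j = i" | "j \<noteq> i" "U j = V j" | "i < j" "j \<notin> B"
    using before[of j] B(1)[of j] j by force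
  then show False
  proof cases
    case 1
    then show ?thesis using le less by simp
  next
    case 2
    then show ?thesis using full_combs_less[OF U i j] le by simp
  next
    case 3
    then have "j \<in> {2..k} - B" "i \<in> {1..<j}" using i j by auto
    then have "\<pi> j \<in> B" "\<pi> j \<noteq> j" "c (U i) j \<le> c (U (\<pi> j)) j" using \<pi>[of j] by auto
    moreover have "c (V (\<pi> j)) j < c (V j) j"
      using full_combs_less[OF V _ j, of "\<pi> j"] \<open>\<pi> j \<in> B\<close> \<open>\<pi> j \<noteq> j\<close> B(2) by blast
    ultimately show ?thesis using le B(1)[of "\<pi> j"] by simp
  qed
qed

text \<open>Position 1 is exempt, having no earlier positions whose coordinates would need a
  bound.\<close>

definition guarded :: "(nat \<Rightarrow> nat) \<Rightarrow> nat set \<Rightarrow> (nat \<Rightarrow> 'a) set" where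
  "guarded \<pi> B = {U \<in> full_combs. \<forall>j\<in>{2..k} - B.
     \<pi> j \<in> B \<and> \<pi> j \<noteq> j \<and> (\<forall>m\<in>{1..<j}. c (U m) j \<le> c (U (\<pi> j)) j)}"

text \<open>At the first possible difference, the guards of \<open>U\<close> give one inequality and
  those of \<open>V\<close>, with the same \<open>\<pi>\<close> and \<open>B\<close>, the
  other.\<close>

lemma inj_on_restrict_guarded:
  assumes "B \<subseteq> {1..k}"
  shows "inj_on (\<lambda>U. restrict U B) (guarded \<pi> B)"
proof (rule inj_onI)
  fix U V assume U: "U \<in> guarded \<pi> B" and V: "V \<in> guarded \<pi> B"
    and eq: "restrict U B = restrict V B"
  have UV: "U \<in> full_combs" "V \<in> full_combs" using U V unfolding guarded_def by auto
  have B: "U j = V j" if "j \<in> B" for j using eq that by (metis restrict_apply')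
  have "i \<in> {1..k} \<longrightarrow> U i = V i" for i
  proof (induction i rule: less_induct)
    case (less i)
    show ?case
    proof
      assume i: "i \<in> {1..k}"
      then have before: "U j = V j" if "j \<in> {1..<i}" for j using less that by auto
      have "c (V i) i \<le> c (U i) i"
        by (rule full_combs_coord_le[OF UV i before B assms, of \<pi>]) (use U in \<open>auto simp: guarded_def\<close>)
      moreover have "c (U i) i \<le> c (V i) i"
        by (rule full_combs_coord_le[OF UV(2,1) i before[symmetric] B[symmetric] assms, of \<pi>])
          (use V in \<open>auto simp: guarded_def\<close>)
      ultimately show "U i = V i"
        using coord_inj_insert[OF full_combs_mem[OF UV(1) i] full_combs_mem[OF UV(2) i] i] by simp
    qed
  qed
  moreover have "U \<in> extensional {1..k}" "V \<in> extensional {1..k}"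
    using full_combs_PiE[OF UV(1)] full_combs_PiE[OF UV(2)] unfolding PiE_def by auto
  ultimately show "U = V" using extensionalityI by blast
qed

lemma card_guarded_le:
  assumes "B \<subseteq> {1..k}"
  shows "card (guarded \<pi> B) \<le> (card N + 1) ^ card B"
proof -
  have fB: "finite B" using assms finite_subset by blast
  have "(\<lambda>U. restrict U B) ` guarded \<pi> B \<subseteq> (\<Pi>\<^sub>E i\<in>B. insert (d i) N)"
  proof (rule image_subsetI)
    fix U assume "U \<in> guarded \<pi> B"
    then have "U \<in> full_combs" unfolding guarded_def by blast
    then show "restrict U B \<in> (\<Pi>\<^sub>E i\<in>B. insert (d i) N)"
      unfolding restrict_PiE_iff using full_combs_mem assms by blast
  qed
  moreover have "finite (\<Pi>\<^sub>E i\<in>B. insert (d i) N)" using fB finite_N by (intro finite_PiE) auto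
  ultimately have "card (guarded \<pi> B) \<le> card (\<Pi>\<^sub>E i\<in>B. insert (d i) N)"
    by (rule card_inj_on_le[OF inj_on_restrict_guarded[OF assms]])
  also have "\<dots> = (\<Prod>i\<in>B. card (insert (d i) N))" by (rule card_PiE[OF fB])
  also have "\<dots> \<le> (\<Prod>i\<in>B. card N + 1)"
    using finite_N by (intro prod_mono) (auto simp: card_insert_if)
  also have "\<dots> = (card N + 1) ^ card B" by simp
  finally show ?thesis .
qed

lemma full_combs_guarded:
  assumes U: "U \<in> full_combs"
  shows "\<exists>\<pi>\<in>{1..k} \<rightarrow>\<^sub>E {1..k}. \<exists>B\<subseteq>{1..k}. card B \<le> k div 2 \<and> U \<in> guarded \<pi> B"
proof -
  have "\<exists>q\<in>{1..<j}. \<forall>m\<in>{1..<j}. c (U m) j \<le> c (U q) j" if "j \<in> {2..k}" for j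
    by (rule ex_max_on) (use that in auto)
  then obtain q where q: "\<And>j. j \<in> {2..k} \<Longrightarrow> q j \<in> {1..<j}"
      "\<And>j. j \<in> {2..k} \<Longrightarrow> \<forall>m\<in>{1..<j}. c (U m) j \<le> c (U (q j)) j"
    by metis
  \<comment> \<open>The value at 1 is a filler that makes \<open>\<pi>\<close> a member of a
    function space with \<open>k ^ k\<close> elements.\<close>
  define \<pi> where "\<pi> = (\<lambda>j\<in>{1..k}. if j = 1 then 1 else q j)"
  have \<pi>_q: "\<pi> j = q j" if "j \<in> {2..k}" for j using that unfolding \<pi>_def by auto
  have "\<pi> \<in> {1..k} \<rightarrow>\<^sub>E {1..k}"
  proof (rule PiE_I)
    show "\<pi> j \<in> {1..k}" if "j \<in> {1..k}" for j
      using that q(1)[of j] unfolding \<pi>_def by (cases "j = 1") auto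
  qed (auto simp: \<pi>_def)
  moreover have "\<exists>B\<subseteq>{1..k}. card B \<le> k div 2 \<and> U \<in> guarded \<pi> B"
  proof -
    obtain A where A: "A \<subseteq> {1..k}" "\<And>j. j \<in> {2..k} \<Longrightarrow> j \<in> A \<longleftrightarrow> \<pi> j \<notin> A"
      using ex_two_colouring[of k \<pi>] q(1) \<pi>_q by (metis atLeastLessThan_iff)
    \<comment> \<open>Each colour class qualifies as \<open>B\<close>, because \<open>\<pi>\<close>
      maps every other position from 2 on into it; the smaller class is then chosen.\<close>
    have mem: "U \<in> guarded \<pi> B" if "\<And>j. j \<in> {2..k} - B \<Longrightarrow> \<pi> j \<in> B" for B
      unfolding guarded_def using U q that \<pi>_q by fastforce
    have "U \<in> guarded \<pi> A" using A by (intro mem) auto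
    moreover have "U \<in> guarded \<pi> ({1..k} - A)"
    proof (rule mem)
      fix j assume j: "j \<in> {2..k} - ({1..k} - A)"
      then have "j \<in> A" "j \<in> {2..k}" by auto
      moreover have "\<pi> j \<in> {1..k}" using j q(1)[of j] \<pi>_q[of j] by auto
      ultimately show "\<pi> j \<in> {1..k} - A" using A(2)[of j] by blast
    qed
    moreover have "card A + card ({1..k} - A) = k"
      using A(1) card_mono[of "{1..k}" A] by (simp add: card_Diff_subset finite_subset)
    then have "card A \<le> k div 2 \<or> card ({1..k} - A) \<le> k div 2" by linarith
    ultimately show ?thesis using A(1) by blast
  qed
  ultimately show ?thesis by blast
qed

text \<open>The factor \<open>k ^ k\<close> counts the maps \<open>\<pi>\<close> and
  \<open>2 ^ k\<close> bounds the number of sets \<open>B\<close>; the remaining factor bounds the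
  tuples for a fixed pair.\<close>

theorem card_combs_le: "card combs \<le> k ^ k * 2 ^ k * (card N + 1) ^ (k div 2)"
proof -
  define I where "I = ({1..k} \<rightarrow>\<^sub>E {1..k}) \<times> {B. B \<subseteq> {1..k} \<and> card B \<le> k div 2}"
  have finI: "finite I" unfolding I_def by (intro finite_cartesian_product finite_PiE) auto
  have fin_full: "finite full_combs"
    by (rule finite_subset[of _ "\<Pi>\<^sub>E i\<in>{1..k}. insert (d i) N"])
      (use full_combs_PiE finite_N in \<open>auto intro!: finite_PiE\<close>)
  have "combs \<subseteq> (\<lambda>U. restrict U {1..k-1}) ` full_combs" using combs_extend by blast
  then have "card combs \<le> card full_combs"
    using fin_full by (meson card_image_le card_mono finite_imageI le_trans)
  also have "\<dots> \<le> card (\<Union>(\<pi>, B)\<in>I. guarded \<pi> B)"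
  proof (rule card_mono)
    show "finite (\<Union>(\<pi>, B)\<in>I. guarded \<pi> B)"
      by (rule finite_subset[OF _ fin_full]) (auto simp: guarded_def)
    show "full_combs \<subseteq> (\<Union>(\<pi>, B)\<in>I. guarded \<pi> B)"
      using full_combs_guarded unfolding I_def by fastforce
  qed
  also have "\<dots> \<le> (\<Sum>p\<in>I. card (case p of (\<pi>, B) \<Rightarrow> guarded \<pi> B))"
    by (rule card_UN_le[OF finI])
  also have "\<dots> \<le> (\<Sum>p\<in>I. (card N + 1) ^ (k div 2))"
  proof (rule sum_mono)
    fix p assume "p \<in> I"
    then obtain \<pi> B where p: "p = (\<pi>, B)" "B \<subseteq> {1..k}" "card B \<le> k div 2" unfolding I_def by auto
    have "card (guarded \<pi> B) \<le> (card N + 1) ^ card B" by (rule card_guarded_le[OF p(2)])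
    also have "\<dots> \<le> (card N + 1) ^ (k div 2)" using p(3) by (intro power_increasing) auto
    finally show "card (case p of (\<pi>, B) \<Rightarrow> guarded \<pi> B) \<le> (card N + 1) ^ (k div 2)" using p(1) by simp
  qed
  also have "\<dots> = card I * (card N + 1) ^ (k div 2)" by simp
  also have "card I \<le> k ^ k * 2 ^ k"
  proof -
    have "card {B. B \<subseteq> {1..k} \<and> card B \<le> k div 2} \<le> card (Pow {1..k})"
      by (rule card_mono) auto
    moreover have "card ({1..k} \<rightarrow>\<^sub>E {1..k}) = k ^ k" by (simp add: card_PiE)
    ultimately show ?thesis unfolding I_def by (simp add: card_cartesian_product card_Pow)
  qed
  finally show ?thesis by simp
qed

end

section \<open>The reverse lexicographic order and closed epsilon-components\<close>

lemma revlex_less_0: "\<not> revlex_less 0 a b"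
  unfolding revlex_less_def by simp

lemma revlex_less_Suc:
  "revlex_less (Suc k) a b \<longleftrightarrow> a (Suc k) < b (Suc k) \<or> (a (Suc k) = b (Suc k) \<and> revlex_less k a b)"
  unfolding revlex_less_def by auto

lemma revlex_less_irrefl: "\<not> revlex_less k a a"
  by (induction k) (auto simp: revlex_less_0 revlex_less_Suc)

lemma revlex_less_trans: "revlex_less k a b \<Longrightarrow> revlex_less k b c \<Longrightarrow> revlex_less k a c"
  by (induction k) (auto simp: revlex_less_0 revlex_less_Suc)

lemma revlex_less_asym: "revlex_less k a b \<Longrightarrow> \<not> revlex_less k b a"
  using revlex_less_trans revlex_less_irrefl by blast

lemma revlex_less_total:
  assumes "a \<in> extensional {1..k}" "b \<in> extensional {1..k}"
  shows "revlex_less k a b \<or> a = b \<or> revlex_less k b a"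
proof -
  have "revlex_less m a b \<or> (\<forall>i\<in>{1..m}. a i = b i) \<or> revlex_less m b a" for m
    by (induction m) (auto simp: revlex_less_0 revlex_less_Suc le_Suc_eq)
  then show ?thesis using extensionalityI[OF assms] by blast
qed

lemma revlex_less_last: "k \<ge> 1 \<Longrightarrow> a k < b k \<Longrightarrow> revlex_less k a b"
  by (cases k) (auto simp: revlex_less_Suc)

lemma revlex_less_last_le: "revlex_less k a b \<Longrightarrow> a k \<le> b k"
  by (cases k) (auto simp: revlex_less_0 revlex_less_Suc)

lemma revlex_lessI:
  "i \<in> {1..k} \<Longrightarrow> a i < b i \<Longrightarrow> (\<And>j. j \<in> {i+1..k} \<Longrightarrow> a j = b j) \<Longrightarrow> revlex_less k a b"
  by (induction k) (auto simp: revlex_less_0 revlex_less_Suc le_Suc_eq)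

section \<open>Closures of epsilon-components and viability as inequalities\<close>

text \<open>The part \<open>y j < z j\<close> is what distinguishes the closure from a mere
  weakening of inequalities: nearby parameters of the component exceed \<open>y\<close> strictly, so
  they can exclude \<open>z\<close> only in a coordinate where \<open>z\<close> exceeds
  \<open>y\<close>.\<close>

definition closure_cond ::
  "nat \<Rightarrow> (nat \<Rightarrow> real) set \<Rightarrow> (nat \<Rightarrow> real) \<Rightarrow> (nat \<Rightarrow> real) \<Rightarrow> bool" where
  "closure_cond k S y \<epsilon> \<longleftrightarrow> (\<forall>j\<in>{1..k-1}. y j \<le> \<epsilon> j) \<and>
     (\<forall>z\<in>S. revlex_less k z y \<longrightarrow> (\<exists>j\<in>{1..k-1}. \<epsilon> j \<le> z j \<and> y j < z j))"

lemma optimal_iff: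
  assumes "S \<subseteq> extensional {1..k}"
  shows "optimal k S \<epsilon> y \<longleftrightarrow>
    y \<in> S \<and> feasible k \<epsilon> y \<and> (\<forall>z\<in>S. revlex_less k z y \<longrightarrow> \<not> feasible k \<epsilon> z)"
  unfolding optimal_def
  using assms revlex_less_total[of _ k y] revlex_less_asym revlex_less_irrefl by (metis subsetD)

text \<open>The set is an intersection of closed half-spaces and finite unions of closed
  half-spaces.\<close>

lemma closedin_closure_cond:
  assumes "finite S"
  shows "closedin (product_topology (\<lambda>_. euclideanreal) {1..k-1})
    {\<epsilon> \<in> {1..k-1} \<rightarrow>\<^sub>E UNIV. closure_cond k S y \<epsilon>}"
    (is "closedin ?X ?C")
proof -
  have top: "topspace ?X = {1..k-1} \<rightarrow>\<^sub>E UNIV" by simp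
  have proj: "continuous_map ?X euclideanreal (\<lambda>\<epsilon>. \<epsilon> j)" if "j \<in> {1..k-1}" for j
    using continuous_map_product_projection[OF that] .
  have ge: "closedin ?X {\<epsilon> \<in> topspace ?X. y j \<le> \<epsilon> j}" if "j \<in> {1..k-1}" for j
    using closedin_continuous_map_preimage[OF proj[OF that], of "{y j..}"] by simp
  have le: "closedin ?X {\<epsilon> \<in> topspace ?X. \<epsilon> j \<le> t}" if "j \<in> {1..k-1}" for j t
    using closedin_continuous_map_preimage[OF proj[OF that], of "{..t}"] by simp
  define G where "G = (\<lambda>j. {\<epsilon> \<in> topspace ?X. y j \<le> \<epsilon> j})"
  define H where "H = (\<lambda>z. \<Union>j\<in>{j\<in>{1..k-1}. y j < z j}. {\<epsilon> \<in> topspace ?X. \<epsilon> j \<le> z j})"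
  define F where "F = G ` {1..k-1} \<union> H ` {z\<in>S. revlex_less k z y}"
  have "closedin ?X (H z)" for z
    unfolding H_def
  proof (rule closedin_Union)
    fix C assume "C \<in> (\<lambda>j. {\<epsilon> \<in> topspace ?X. \<epsilon> j \<le> z j}) ` {j\<in>{1..k-1}. y j < z j}"
    then obtain j where "j \<in> {1..k-1}" "C = {\<epsilon> \<in> topspace ?X. \<epsilon> j \<le> z j}" by blast
    then show "closedin ?X C" using le[of j "z j"] by blast
  qed simp
  then have "closedin ?X T" if "T \<in> F" for T
    using that ge unfolding F_def G_def by blast
  moreover have "?C = topspace ?X \<inter> \<Inter>F"
  proof (rule set_eqI)
    fix \<epsilon>
    have "\<epsilon> \<in> \<Inter>F \<longleftrightarrow> (\<forall>j\<in>{1..k-1}. \<epsilon> \<in> G j) \<and> (\<forall>z\<in>{z\<in>S. revlex_less k z y}. \<epsilon> \<in> H z)"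
      unfolding F_def by blast
    then show "\<epsilon> \<in> ?C \<longleftrightarrow> \<epsilon> \<in> topspace ?X \<inter> \<Inter>F"
      unfolding closure_cond_def G_def H_def top by blast
  qed
  ultimately show ?thesis
    using closedin_Inter[of "insert (topspace ?X) F" ?X] by (metis Inter_insert closedin_topspace insertE insert_not_empty)
qed

lemma closure_of_optimal:
  assumes S: "finite S" "S \<subseteq> extensional {1..k}" and y: "y \<in> S"
  shows "product_topology (\<lambda>_. euclideanreal) {1..k-1} closure_of
      {\<epsilon> \<in> {1..k-1} \<rightarrow>\<^sub>E UNIV. optimal k S \<epsilon> y} = {\<epsilon> \<in> {1..k-1} \<rightarrow>\<^sub>E UNIV. closure_cond k S y \<epsilon>}"
    (is "?X closure_of ?E = ?C")
proof
  have "?E \<subseteq> ?C"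
    unfolding optimal_iff[OF S(2)] closure_cond_def feasible_def vless_def
    by (auto simp: less_imp_le not_less) (meson atLeastAtMost_iff le_less_trans not_le less_le_trans)
  then show "?X closure_of ?E \<subseteq> ?C"
    by (rule closure_of_minimal[OF _ closedin_closure_cond[OF S(1)]])
next
  show "?C \<subseteq> ?X closure_of ?E"
  proof
    fix \<epsilon> assume \<epsilon>: "\<epsilon> \<in> ?C"
    \<comment> \<open>Raising exactly the tight coordinates by a small \<open>\<eta>\<close> makes
      \<open>y\<close> strictly feasible, and \<open>e\<close> returns to \<open>\<epsilon>\<close>
      as \<open>\<eta>\<close> tends to 0.\<close>
    define e where "e = (\<lambda>\<eta>::real. \<lambda>j\<in>{1..k-1}. if \<epsilon> j = y j then \<epsilon> j + \<eta> else \<epsilon> j)"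
    have e_cont: "continuous_map euclideanreal ?X e"
      unfolding continuous_map_componentwise e_def by (auto intro!: continuous_intros)
    have "e 0 = restrict \<epsilon> {1..k-1}" unfolding e_def by auto
    then have e0: "e 0 = \<epsilon>" using \<epsilon> by (auto simp: PiE_def extensional_restrict)
    \<comment> \<open>Below all these gaps, no raised coordinate passes a blocking
      \<open>z j\<close>. The element 1 keeps the set nonempty.\<close>
    define G where "G = insert 1 {z j - y j | z j. z \<in> S \<and> j \<in> {1..k-1} \<and> y j < z j}"
    have "finite ((\<lambda>(z, j). z j - y j) ` (S \<times> {1..k-1}))" using S(1) by simp
    then have finG: "finite G"
      unfolding G_def by (rule finite_insert[THEN iffD2, OF finite_subset[rotated]]) auto
    have G_pos: "0 < g" if "g \<in> G" for g using that unfolding G_def by auto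
    define \<eta>0 where "\<eta>0 = Min G"
    have \<eta>0: "0 < \<eta>0" using Min_in[OF finG] G_pos unfolding \<eta>0_def G_def by blast
    have \<eta>0_le: "\<eta>0 \<le> z j - y j" if "z \<in> S" "j \<in> {1..k-1}" "y j < z j" for z j
      unfolding \<eta>0_def by (rule Min_le[OF finG]) (use that in \<open>auto simp: G_def\<close>)
    have e_in: "e \<eta> \<in> ?E" if \<eta>: "0 < \<eta>" "\<eta> < \<eta>0" for \<eta>
    proof -
      have "y j < e \<eta> j" if "j \<in> {1..k-1}" for j
        using \<epsilon> that \<eta>(1) unfolding closure_cond_def e_def by (auto simp: less_le)
      then have "feasible k (e \<eta>) y" unfolding feasible_def vless_def by blast
      moreover have "\<not> feasible k (e \<eta>) z" if z: "z \<in> S" "revlex_less k z y" for z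
      proof -
        obtain j where j: "j \<in> {1..k-1}" "\<epsilon> j \<le> z j" "y j < z j"
          using \<epsilon> z unfolding closure_cond_def by blast
        have "e \<eta> j \<le> z j" using j \<eta>0_le[OF z(1) j(1,3)] \<eta>(2) unfolding e_def by auto
        then show ?thesis using j(1) unfolding feasible_def vless_def by (auto simp: not_less)
      qed
      moreover have "e \<eta> \<in> {1..k-1} \<rightarrow>\<^sub>E UNIV" unfolding e_def by auto
      ultimately show ?thesis unfolding optimal_iff[OF S(2)] using y by blast
    qed
    have "\<exists>\<epsilon>'. \<epsilon>' \<in> ?E \<and> \<epsilon>' \<in> T" if T: "\<epsilon> \<in> T" "openin ?X T" for T
    proof -
      have "open {\<eta>. e \<eta> \<in> T}"
        using openin_continuous_map_preimage[OF e_cont T(2)] by simp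
      moreover have "0 \<in> {\<eta>. e \<eta> \<in> T}" using e0 T(1) by simp
      ultimately obtain r where r: "0 < r" "ball 0 r \<subseteq> {\<eta>. e \<eta> \<in> T}"
        using open_contains_ball by blast
      define \<eta> where "\<eta> = min r \<eta>0 / 2"
      have "0 < \<eta>" "\<eta> < \<eta>0" "\<eta> \<in> ball 0 r" using r(1) \<eta>0 unfolding \<eta>_def by (auto simp: min_def)
      then show ?thesis using e_in r(2) by blast
    qed
    then show "\<epsilon> \<in> ?X closure_of ?E" unfolding in_closure_of using \<epsilon> by auto
  qed
qed

lemma dummy_extensional: "dummy k M t \<in> extensional {1..k}"
  unfolding dummy_def by simp

lemma finite_dummies: "finite (dummies k M)"
  unfolding dummies_def by simp

lemma dummies_extensional: "dummies k M \<subseteq> extensional {1..k}"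
  unfolding dummies_def using dummy_extensional by auto

text \<open>The facets prescribe every coordinate of a common parameter, so their intersection can
  contain nothing but \<open>viable_parameter k \<Y>\<close>.\<close>

lemma viable_iff:
  assumes N: "finite N" "N \<subseteq> extensional {1..k}"
  shows "\<Y> \<in> viable k M N \<longleftrightarrow> \<Y> \<in> {1..k-1} \<rightarrow>\<^sub>E (N \<union> dummies k M) \<and> inj_on \<Y> {1..k-1} \<and>
    (\<forall>i\<in>{1..k-1}. closure_cond k (if \<Y> i \<in> N then N else N \<union> dummies k M) (\<Y> i) (viable_parameter k \<Y>))"
    (is "_ \<longleftrightarrow> ?A \<and> ?B \<and> ?C")
proof -
  have facet: "eps_facet k M N i y =
      {\<epsilon> \<in> {1..k-1} \<rightarrow>\<^sub>E UNIV. closure_cond k (if y \<in> N then N else N \<union> dummies k M) y \<epsilon> \<and> \<epsilon> i = y i}"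
    if y: "y \<in> N \<union> dummies k M" for i y
    unfolding eps_facet_def eps_component_def
    by (subst closure_of_optimal) (use N y finite_dummies dummies_extensional in auto)
  have "(\<Inter>i\<in>{1..k-1}. eps_facet k M N i (\<Y> i)) \<noteq> {} \<longleftrightarrow> ?C" if A: ?A
  proof (cases "{1..k-1} = ({} :: nat set)")
    case True
    then show ?thesis by simp
  next
    case ne: False
    have mem: "\<Y> i \<in> N \<union> dummies k M" if "i \<in> {1..k-1}" for i using A that by blast
    have par: "viable_parameter k \<Y> \<in> {1..k-1} \<rightarrow>\<^sub>E UNIV" unfolding viable_parameter_def by simp
    show ?thesis
    proof
      assume "(\<Inter>i\<in>{1..k-1}. eps_facet k M N i (\<Y> i)) \<noteq> {}"
      then obtain \<epsilon> where \<epsilon>: "\<And>i. i \<in> {1..k-1} \<Longrightarrow> \<epsilon> \<in> eps_facet k M N i (\<Y> i)" by blast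
      have "\<epsilon> = viable_parameter k \<Y>"
      proof (rule extensionalityI[of _ "{1..k-1}"])
        show "\<epsilon> \<in> extensional {1..k-1}" using \<epsilon> facet[OF mem] ne by (fastforce simp: PiE_def)
        show "viable_parameter k \<Y> \<in> extensional {1..k-1}" unfolding viable_parameter_def by simp
        show "\<epsilon> i = viable_parameter k \<Y> i" if "i \<in> {1..k-1}" for i
          using \<epsilon>[OF that] facet[OF mem[OF that]] that unfolding viable_parameter_def by simp
      qed
      then show ?C using \<epsilon> facet[OF mem] by blast
    next
      assume ?C
      then have "viable_parameter k \<Y> \<in> eps_facet k M N i (\<Y> i)" if "i \<in> {1..k-1}" for i
        using that facet[OF mem[OF that]] par unfolding viable_parameter_def by simp
      then show "(\<Inter>i\<in>{1..k-1}. eps_facet k M N i (\<Y> i)) \<noteq> {}" by blast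
    qed
  qed
  then show ?thesis unfolding viable_def by blast
qed

text \<open>A foreign dummy for coordinate \<open>t\<close> at position \<open>i\<close> would push
  the parameter up to \<open>M\<close> in coordinate \<open>t\<close>. Then position
  \<open>t\<close> must hold the same dummy, against distinctness.\<close>

lemma viable_dummy:
  assumes N: "finite N" "N \<subseteq> extensional {1..k}" "0 < M"
    and bd: "\<And>y j. y \<in> N \<Longrightarrow> j \<in> {1..k} \<Longrightarrow> y j < M"
    and Y: "\<Y> \<in> viable k M N" and i: "i \<in> {1..k-1}"
  shows "\<Y> i \<in> insert (dummy k M i) N"
proof (rule ccontr)
  assume *: "\<not> ?thesis"
  note V = Y[unfolded viable_iff[OF N(1,2)]]
  have "\<Y> i \<in> N \<union> dummies k M" using V i by blast
  then obtain t where t: "t \<in> {1..k-1}" "\<Y> i = dummy k M t"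
    using * unfolding dummies_def by blast
  then have ti: "t \<noteq> i" using * by auto
  have "closure_cond k (if \<Y> i \<in> N then N else N \<union> dummies k M) (\<Y> i) (viable_parameter k \<Y>)"
    using V i by blast
  then have "\<Y> i t \<le> viable_parameter k \<Y> t" using t(1) unfolding closure_cond_def by blast
  moreover have tk: "t \<in> {1..k}" using t(1) by auto
  then have "\<Y> i t = M" using t(2) unfolding dummy_def by simp
  ultimately have M: "M \<le> \<Y> t t" using t(1) unfolding viable_parameter_def by simp
  then have "\<Y> t \<notin> N" using bd[of "\<Y> t" t] M tk by auto
  then obtain s where s: "s \<in> {1..k-1}" "\<Y> t = dummy k M s" using V t(1) unfolding dummies_def by blast
  then have "s = t" using M N(3) tk unfolding dummy_def by (auto split: if_splits)
  then have "\<Y> t = \<Y> i" using s t by simp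
  then show False using V i t(1) ti inj_onD[of \<Y> "{1..k-1}" t i] by blast
qed

text \<open>Points of \<open>N\<close> have a larger last coordinate than the dummy, so only other
  dummies can precede it; each of those is excluded in its own coordinate, where it has the value
  \<open>M\<close>.\<close>

lemma closure_cond_dummy:
  assumes "\<And>z. z \<in> N \<Longrightarrow> - M < z k" "0 < M" and i: "i \<in> {1..k-1}"
    and \<epsilon>: "\<And>j. j \<in> {1..k-1} \<Longrightarrow> - M \<le> \<epsilon> j \<and> \<epsilon> j \<le> M" "M \<le> \<epsilon> i"
  shows "closure_cond k (N \<union> dummies k M) (dummy k M i) \<epsilon>"
  unfolding closure_cond_def
proof (intro conjI ballI impI)
  fix j assume "j \<in> {1..k-1}"
  then show "dummy k M i j \<le> \<epsilon> j" using \<epsilon> unfolding dummy_def by auto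
next
  fix z assume z: "z \<in> N \<union> dummies k M" "revlex_less k z (dummy k M i)"
  have "dummy k M i k = - M" using i unfolding dummy_def by auto
  then have "z \<notin> N" using revlex_less_last_le[OF z(2)] assms(1)[of z] by auto
  then obtain s where s: "s \<in> {1..k-1}" "z = dummy k M s" using z(1) unfolding dummies_def by auto
  have "s \<noteq> i" using z(2) s(2) revlex_less_irrefl by auto
  then have "\<epsilon> s \<le> z s \<and> dummy k M i s < z s" using s \<epsilon>(1)[OF s(1)] assms(2) unfolding dummy_def by auto
  then show "\<exists>j\<in>{1..k-1}. \<epsilon> j \<le> z j \<and> dummy k M i j < z j" using s(1) by blast
qed

section \<open>The perturbation\<close>

lemma perturb_notin: "y \<notin> N \<Longrightarrow> perturb k \<delta> N y = y"
  unfolding perturb_def by simp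

lemma perturb_extensional: "y \<in> N \<Longrightarrow> perturb k \<delta> N y \<in> extensional {1..k}"
  unfolding perturb_def by simp

locale nondominated_set =
  fixes k :: nat and N :: "(nat \<Rightarrow> real) set" and \<delta> M :: real
  assumes k2: "k \<ge> 2"
    and finite_N: "finite N"
    and ext: "N \<subseteq> extensional {1..k}"
    and not_vle: "\<And>x y. x \<in> N \<Longrightarrow> y \<in> N \<Longrightarrow> \<not> vle {1..k} x y"
    and adm: "admissible_constants k N \<delta> M"
begin

abbreviation c :: "(nat \<Rightarrow> real) \<Rightarrow> nat \<Rightarrow> real" where "c \<equiv> perturb k \<delta> N"

lemma \<delta>_pos: "0 < \<delta>" and M_pos: "0 < M"
  using adm unfolding admissible_constants_def by auto

lemma abs_bound: "y \<in> N \<Longrightarrow> j \<in> {1..k} \<Longrightarrow> \<delta> + \<bar>y j\<bar> < M"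
  using adm unfolding admissible_constants_def by blast

lemma gap: "y \<in> N \<Longrightarrow> z \<in> N \<Longrightarrow> j \<in> {1..k} \<Longrightarrow> y j < z j \<Longrightarrow> y j + \<delta> < z j"
  using adm unfolding admissible_constants_def by fastforce

lemma total: "y \<in> N \<Longrightarrow> z \<in> N \<Longrightarrow> revlex_less k y z \<or> y = z \<or> revlex_less k z y"
  using revlex_less_total ext by blast

lemma lex_rank_less:
  assumes "y \<in> N" "revlex_less k y z"
  shows "lex_rank k N y < lex_rank k N z"
proof -
  have "{s \<in> N. revlex_less k s y} \<subset> {s \<in> N. revlex_less k s z}"
    using assms revlex_less_trans revlex_less_irrefl by blast
  then have "card {s \<in> N. revlex_less k s y} < card {s \<in> N. revlex_less k s z}"
    using finite_N by (intro psubset_card_mono) auto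
  then show ?thesis unfolding lex_rank_def by simp
qed

lemma lex_rank_le: "y \<in> N \<Longrightarrow> lex_rank k N y \<le> card N"
proof -
  assume "y \<in> N"
  then have "{s \<in> N. revlex_less k s y} \<subset> N" using revlex_less_irrefl by blast
  then have "card {s \<in> N. revlex_less k s y} < card N" by (rule psubset_card_mono[OF finite_N])
  then show ?thesis unfolding lex_rank_def by simp
qed

lemma perturb_bounds:
  assumes "y \<in> N" "j \<in> {1..k}"
  shows "y j \<le> c y j" "c y j \<le> y j + real (lex_rank k N y) * \<delta> / (real (card N) + 1)" "c y j < y j + \<delta>"
proof -
  let ?o = "real (lex_rank k N y) * \<delta> / (real (card N) + 1)"
  have "real (lex_rank k N y) * \<delta> < \<delta> * (real (card N) + 1)"
    using lex_rank_le[OF assms(1)] \<delta>_pos by (simp add: mult.commute)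
  then have "?o < \<delta>" by (simp add: divide_less_eq)
  moreover have "0 \<le> ?o" using \<delta>_pos by simp
  ultimately show "y j \<le> c y j" "c y j \<le> y j + ?o" "c y j < y j + \<delta>"
    using assms \<delta>_pos unfolding perturb_def by auto
qed

text \<open>Offsets stay below \<open>\<delta>\<close> and hence below every gap. In a tie the later
  point is shifted, with the earlier one as witness, and its larger rank gives it the larger offset
  whether or not the earlier one moved.\<close>

lemma perturb_less:
  assumes "y \<in> N" "z \<in> N" "j \<in> {1..k}" "y j < z j \<or> (y j = z j \<and> revlex_less k y z)"
  shows "c y j < c z j"
  using assms(4)
proof (elim disjE conjE)
  assume "y j < z j"
  then show ?thesis
    using gap[OF assms(1-3)] perturb_bounds[OF assms(1,3)] perturb_bounds[OF assms(2,3)] by simp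
next
  assume eq: "y j = z j" and less: "revlex_less k y z"
  have "c y j \<le> y j + real (lex_rank k N y) * \<delta> / (real (card N) + 1)"
    by (rule perturb_bounds(2)[OF assms(1,3)])
  also have "\<dots> < z j + real (lex_rank k N z) * \<delta> / (real (card N) + 1)"
    using lex_rank_less[OF assms(1) less] \<delta>_pos eq by (simp add: divide_strict_right_mono)
  also have "\<dots> = c z j"
    using assms(1-3) eq less unfolding perturb_def by auto
  finally show ?thesis .
qed

lemma perturb_less_iff:
  assumes "y \<in> N" "z \<in> N" "j \<in> {1..k}"
  shows "c y j < c z j \<longleftrightarrow> y j < z j \<or> (y j = z j \<and> revlex_less k y z)"
proof
  assume less: "c y j < c z j"
  then have "y \<noteq> z" by auto
  moreover have "\<not> (z j < y j \<or> (z j = y j \<and> revlex_less k z y))"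
    using perturb_less[OF assms(2,1,3)] less by auto
  ultimately show "y j < z j \<or> (y j = z j \<and> revlex_less k y z)" using total[OF assms(1,2)] by fastforce
qed (rule perturb_less[OF assms])

text \<open>Ties in coordinate \<open>k\<close> are broken by the lexicographic order, so the
  perturbed last coordinate encodes that order completely.\<close>

lemma perturb_last_less_iff:
  assumes "y \<in> N" "z \<in> N"
  shows "c y k < c z k \<longleftrightarrow> revlex_less k y z"
  using perturb_less_iff[OF assms, of k] k2 revlex_less_last[of k y z] revlex_less_last_le[of k y z]
  by fastforce

lemma dummy_notin: "t \<in> {1..k} \<Longrightarrow> dummy k M t \<notin> N"
  using abs_bound[of "dummy k M t" t] \<delta>_pos unfolding dummy_def by auto

lemma perturb_dummy: "t \<in> {1..k} \<Longrightarrow> c (dummy k M t) = dummy k M t"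
  using dummy_notin perturb_notin by blast

sublocale gp: generic_points k M N "dummy k M" c
proof
  show "2 \<le> k" "finite N" "0 < M" using k2 finite_N M_pos by auto
next
  fix x y j assume "x \<in> N" "y \<in> N" "j \<in> {1..k}" "c x j = c y j"
  then show "x = y"
    using perturb_less_iff[of x y j] perturb_less_iff[of y x j] total[of x y] by fastforce
next
  fix x j assume "x \<in> N" "j \<in> {1..k}"
  then show "- M < c x j" "c x j < M" using perturb_bounds[of x j] abs_bound[of x j] \<delta>_pos by auto
next
  fix t :: nat assume "t \<in> {1..k}"
  then show "c (dummy k M t) t = M" by (subst perturb_dummy) (auto simp: dummy_def)
next
  fix t j :: nat assume "t \<in> {1..k}" "j \<in> {1..k}" "j \<noteq> t"
  then show "c (dummy k M t) j = - M" by (subst perturb_dummy) (auto simp: dummy_def)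
next
  fix x y assume xy: "x \<in> N" "y \<in> N"
  show "\<exists>j\<in>{1..k}. c y j \<le> c x j"
  proof (rule ccontr)
    assume "\<not> ?thesis"
    then have less: "c x j < c y j" if "j \<in> {1..k}" for j using that by (meson not_le)
    then have le: "\<forall>j\<in>{1..k}. x j \<le> y j" using perturb_less_iff[OF xy] by fastforce
    then have "\<forall>j\<in>{1..k}. x j = y j" using not_vle[OF xy] unfolding vle_def by blast
    then have "x = y" using extensionalityI[of x "{1..k}" y] xy ext by blast
    then show False using less[of k] k2 by simp
  qed
qed

section \<open>Identification of the true combinations\<close>

text \<open>This yields the index that \<open>closure_cond\<close> asks for. Its strict part comes
  from general position if \<open>j = i\<close> and from the pairwise inequalities
  otherwise.\<close>

lemma combs_less_point_imp:
  assumes Y: "Y \<in> gp.combs" and i: "i \<in> {1..k-1}" and z: "z \<in> N" "c z k < c (Y i) k"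
  shows "\<exists>j\<in>{1..k-1}. c (Y j) j \<le> c z j \<and> c (Y i) j < c z j"
proof -
  have "\<not> gp.below Y z" using gp.combs_last_le[OF Y z(1) _ i] z(2) by auto
  then obtain j where j: "j \<in> {1..k-1}" "c (Y j) j \<le> c z j"
    unfolding gp.below_def by (auto simp: not_less)
  have "c (Y i) j < c z j"
  proof (cases "j = i")
    case True
    have ik: "i \<in> {1..k}" using i by auto
    have "Y i \<noteq> z" using z(2) by auto
    moreover have "Y i \<in> N"
      using gp.combs_mem[OF Y i] j(2) True gp.coord_lt[OF z(1) ik] gp.coord_d_same[OF ik] by auto
    ultimately have "c (Y i) i \<noteq> c z i" using gp.coord_inj[OF _ z(1) ik] by blast
    then show ?thesis using j(2) True by simp
  next
    case False
    then show ?thesis using gp.combs_less[OF Y i j(1)] j(2) by simp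
  qed
  then show ?thesis using j by blast
qed

text \<open>The perturbation never reverses a strict inequality, and dummies stay outside the range
  of perturbed coordinates because of the margin \<open>\<delta>\<close> in the choice of
  \<open>M\<close>.\<close>

lemma unperturb_le:
  assumes "x \<in> insert (dummy k M i) N" "y \<in> insert (dummy k M j) N" "i \<in> {1..k}" "j \<in> {1..k}" "l \<in> {1..k}"
    and "c x l \<le> c y l"
  shows "x l \<le> y l"
proof (cases "x \<in> N")
  case x: True
  show ?thesis
  proof (cases "y \<in> N")
    case True
    then show ?thesis using x assms perturb_less_iff[of y x l] by (meson not_le)
  next
    case False
    then have "y = dummy k M j" "c y = y" using assms(2) perturb_notin by auto
    then show ?thesis
      using assms x perturb_bounds(1)[OF x assms(5)] by simp
  qed
next
  case x: False
  then have cx: "x = dummy k M i" "c x = x" using assms(1) perturb_notin by auto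
  then have xl: "x l = M \<or> x l = - M" using assms(5) unfolding dummy_def by auto
  show ?thesis
  proof (cases "y \<in> N")
    case True
    then show ?thesis using gp.coord_lt[OF True assms(5)] abs_bound[OF True assms(5)] \<delta>_pos xl cx assms(6)
      by auto
  next
    case False
    then show ?thesis using assms cx perturb_notin by auto
  qed
qed

lemma combs_viable:
  assumes Y: "Y \<in> gp.combs"
  shows "Y \<in> viable k M N" "(\<lambda>i\<in>{1..k-1}. c (Y i)) \<in> viable k M (c ` N)"
proof -
  have ik: "i \<in> {1..k}" if "i \<in> {1..k-1}" for i using that by auto
  note mem = gp.combs_mem[OF Y]
  have mem_D: "Y i \<in> N \<union> dummies k M" if "i \<in> {1..k-1}" for i
    using mem[OF that] that unfolding dummies_def by auto
  have inj_c: "inj_on (\<lambda>i. c (Y i)) {1..k-1}"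
    by (rule inj_onI) (metis gp.combs_less[OF Y] less_irrefl)
  have c_le: "c (Y i) j \<le> c (Y j) j" if "i \<in> {1..k-1}" "j \<in> {1..k-1}" for i j
    using gp.combs_less[OF Y that] by (cases "i = j") auto
  have le: "Y i j \<le> Y j j" if "i \<in> {1..k-1}" "j \<in> {1..k-1}" for i j
    using unperturb_le[OF mem[OF that(1)] mem[OF that(2)] _ _ _ c_le[OF that]] ik that by blast
  have bd_c: "- M \<le> c (Y j) j \<and> c (Y j) j \<le> M" if "j \<in> {1..k-1}" for j
    using gp.coord_ge gp.coord_le mem[OF that] ik[OF that] by blast
  have bd: "- M \<le> Y j j \<and> Y j j \<le> M" if "j \<in> {1..k-1}" for j
    using mem[OF that] abs_bound[of "Y j" j] ik[OF that] M_pos \<delta>_pos unfolding dummy_def by auto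
  have kk: "k \<in> {1..k}" using k2 by auto
  show "Y \<in> viable k M N"
    unfolding viable_iff[OF finite_N ext]
  proof (intro conjI ballI)
    show "Y \<in> {1..k-1} \<rightarrow>\<^sub>E N \<union> dummies k M"
      using mem_D gp.combs_ext[OF Y] by (auto simp: PiE_def)
    show "inj_on Y {1..k-1}" using inj_c unfolding inj_on_def by metis
    fix i assume i: "i \<in> {1..k-1}"
    show "closure_cond k (if Y i \<in> N then N else N \<union> dummies k M) (Y i) (viable_parameter k Y)"
    proof (cases "Y i \<in> N")
      case True
      have "\<exists>j\<in>{1..k-1}. Y j j \<le> z j \<and> Y i j < z j" if z: "z \<in> N" "revlex_less k z (Y i)" for z
      proof -
        obtain j where j: "j \<in> {1..k-1}" "c (Y j) j \<le> c z j" "c (Y i) j < c z j"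
          using combs_less_point_imp[OF Y i z(1)] perturb_last_less_iff[OF z(1) True] z(2) by blast
        \<comment> \<open>A tie would require \<open>Y i\<close> to precede \<open>z\<close>
          lexicographically, but \<open>z\<close> precedes \<open>Y i\<close>.\<close>
        have "Y i j < z j"
          using perturb_less_iff[OF True z(1) ik[OF j(1)]] j(3) revlex_less_asym[OF z(2)] by blast
        moreover have "Y j j \<le> z j"
          using unperturb_le[OF mem[OF j(1)] _ ik[OF j(1)] ik[OF j(1)] ik[OF j(1)] j(2)] z(1) by blast
        ultimately show ?thesis using j(1) by blast
      qed
      then show ?thesis using True le[OF i] unfolding closure_cond_def viable_parameter_def by auto
    next
      case False
      then have "Y i = dummy k M i" using mem[OF i] by blast
      moreover have "closure_cond k (N \<union> dummies k M) (dummy k M i) (viable_parameter k Y)"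
      proof (rule closure_cond_dummy[OF _ M_pos i])
        show "- M < z k" if "z \<in> N" for z using abs_bound[OF that kk] \<delta>_pos by auto
        show "- M \<le> viable_parameter k Y j \<and> viable_parameter k Y j \<le> M" if "j \<in> {1..k-1}" for j
          using bd[OF that] that unfolding viable_parameter_def by simp
        show "M \<le> viable_parameter k Y i"
          using i \<open>Y i = dummy k M i\<close> unfolding viable_parameter_def dummy_def by auto
      qed
      ultimately show ?thesis using False by simp
    qed
  qed
  let ?Y = "\<lambda>i\<in>{1..k-1}. c (Y i)"
  have par: "viable_parameter k ?Y j = c (Y j) j" if "j \<in> {1..k-1}" for j
    using that unfolding viable_parameter_def by simp
  have cN: "finite (c ` N)" "c ` N \<subseteq> extensional {1..k}" using finite_N perturb_extensional by auto
  show "?Y \<in> viable k M (c ` N)"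
    unfolding viable_iff[OF cN]
  proof (intro conjI ballI)
    have "c (Y i) \<in> c ` N \<union> dummies k M" if i: "i \<in> {1..k-1}" for i
      using mem[OF i] perturb_dummy[OF ik[OF i]] i unfolding dummies_def by auto
    then show "?Y \<in> {1..k-1} \<rightarrow>\<^sub>E c ` N \<union> dummies k M" by auto
    show "inj_on ?Y {1..k-1}" using inj_c by (simp add: inj_on_def)
    fix i assume i: "i \<in> {1..k-1}"
    have "closure_cond k (if c (Y i) \<in> c ` N then c ` N else c ` N \<union> dummies k M) (c (Y i)) (viable_parameter k ?Y)"
    proof (cases "Y i \<in> N")
      case True
      have "\<exists>j\<in>{1..k-1}. c (Y j) j \<le> c z j \<and> c (Y i) j < c z j"
        if z: "z \<in> N" "revlex_less k (c z) (c (Y i))" for z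
      proof -
        have "c z \<noteq> c (Y i)" using z(2) revlex_less_irrefl by metis
        then have "c z k \<noteq> c (Y i) k" using gp.coord_inj[OF z(1) True kk] by metis
        then have "c z k < c (Y i) k" using revlex_less_last_le[OF z(2)] by simp
        then show ?thesis by (rule combs_less_point_imp[OF Y i z(1)])
      qed
      then show ?thesis using True c_le[OF i] par unfolding closure_cond_def by auto
    next
      case False
      then have Yi: "Y i = dummy k M i" "c (Y i) = dummy k M i"
        using mem[OF i] perturb_dummy[OF ik[OF i]] by auto
      have "dummy k M i i = M" using ik[OF i] unfolding dummy_def by simp
      then have "dummy k M i \<notin> c ` N" using gp.coord_lt[OF _ ik[OF i]] by force
      moreover have "closure_cond k (c ` N \<union> dummies k M) (dummy k M i) (viable_parameter k ?Y)"
      proof (rule closure_cond_dummy[OF _ M_pos i])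
        show "- M < z k" if "z \<in> c ` N" for z using that gp.coord_gt[OF _ kk] by auto
        show "- M \<le> viable_parameter k ?Y j \<and> viable_parameter k ?Y j \<le> M" if "j \<in> {1..k-1}" for j
          using bd_c[OF that] par[OF that] by simp
        show "M \<le> viable_parameter k ?Y i"
          using par[OF i] Yi(1) gp.coord_d_same[OF ik[OF i]] by simp
      qed
      ultimately show ?thesis using Yi(2) by simp
    qed
    then show "closure_cond k (if ?Y i \<in> c ` N then c ` N else c ` N \<union> dummies k M) (?Y i) (viable_parameter k ?Y)"
      using i by simp
  qed
qed

text \<open>Viability of \<open>Y\<close> places the dummies. Perturbed viability gives weak
  inequalities, which distinctness and general position make strict.\<close>

lemma viable_combs:
  assumes Y: "Y \<in> viable k M N" and cY: "(\<lambda>i\<in>{1..k-1}. c (Y i)) \<in> viable k M (c ` N)"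
  shows "Y \<in> gp.combs"
proof -
  let ?Y = "\<lambda>i\<in>{1..k-1}. c (Y i)"
  have ik: "i \<in> {1..k}" if "i \<in> {1..k-1}" for i using that by auto
  have kk: "k \<in> {1..k}" using k2 by auto
  have cN: "finite (c ` N)" "c ` N \<subseteq> extensional {1..k}" using finite_N perturb_extensional by auto
  note V = cY[unfolded viable_iff[OF cN]]
  have par: "viable_parameter k ?Y j = c (Y j) j" if "j \<in> {1..k-1}" for j
    using that unfolding viable_parameter_def by simp
  have mem: "Y i \<in> insert (dummy k M i) N" if "i \<in> {1..k-1}" for i
    by (rule viable_dummy[OF finite_N ext M_pos _ Y that]) (use abs_bound \<delta>_pos in fastforce)
  have cond: "closure_cond k (if c (Y i) \<in> c ` N then c ` N else c ` N \<union> dummies k M) (c (Y i)) (viable_parameter k ?Y)"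
    if "i \<in> {1..k-1}" for i
  proof -
    have "closure_cond k (if ?Y i \<in> c ` N then c ` N else c ` N \<union> dummies k M) (?Y i) (viable_parameter k ?Y)"
      using V that by blast
    then show ?thesis using that by simp
  qed
  have c_le: "c (Y i) j \<le> c (Y j) j" if "i \<in> {1..k-1}" "j \<in> {1..k-1}" for i j
    using cond[OF that(1)] par[OF that(2)] that(2) unfolding closure_cond_def by metis
  have less: "c (Y i) j < c (Y j) j" if ij: "i \<in> {1..k-1}" "j \<in> {1..k-1}" "i \<noteq> j" for i j
  proof -
    have "?Y i \<noteq> ?Y j" using V ij inj_onD[of ?Y "{1..k-1}" i j] by blast
    then have ne: "Y i \<noteq> Y j" using ij by auto
    show ?thesis
    proof (cases "Y i \<in> N")
      case True
      then have "Y i \<in> insert (dummy k M j) N" by blast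
      then have "c (Y i) j \<noteq> c (Y j) j"
        using gp.coord_inj_insert[OF _ mem[OF ij(2)] ik[OF ij(2)]] ne by blast
      then show ?thesis using c_le[OF ij(1,2)] by simp
    next
      case False
      then have "c (Y i) j = - M"
        using mem[OF ij(1)] gp.coord_d_other[OF ik[OF ij(1)] ik[OF ij(2)]] ij(3) by auto
      then show ?thesis
        using mem[OF ij(2)] gp.coord_gt[OF _ ik[OF ij(2)]] gp.coord_d_same[OF ik[OF ij(2)]] M_pos by auto
    qed
  qed
  have last: "c (Y i) k \<le> c z k" if z: "z \<in> N" "gp.below Y z" and i: "i \<in> {1..k-1}" for z i
  proof (rule ccontr)
    assume "\<not> ?thesis"
    then have "c z k < c (Y i) k" by simp
    then have "revlex_less k (c z) (c (Y i))" using k2 by (intro revlex_less_last) auto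
    then obtain j where "j \<in> {1..k-1}" "viable_parameter k ?Y j \<le> c z j"
      using cond[OF i] z(1) unfolding closure_cond_def by (metis UnI1 imageI)
    then show False using par z(2) unfolding gp.below_def by force
  qed
  have "Y \<in> (\<Pi>\<^sub>E i\<in>{1..k-1}. insert (dummy k M i) N)"
    using mem Y unfolding viable_def by (auto simp: PiE_def)
  then show ?thesis unfolding gp.combs_def using less last by blast
qed

lemma true_combinations_eq: "true_combinations k \<delta> M N = gp.combs"
  unfolding true_combinations_def using combs_viable viable_combs by blast

section \<open>Scions, optimality and the leading condition in perturbed coordinates\<close>

text \<open>The component \<open>Y i\<close> precedes the optimal \<open>y\<close>
  lexicographically, so the perturbation resolves every tie between them in favour of
  \<open>Y i\<close>.\<close>

lemma combs_coord_le_iff: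
  assumes "Y \<in> gp.combs" "gp.opt Y y" "i \<in> {1..k-1}" "l \<in> {1..k-1}" "i \<noteq> l"
  shows "Y i l \<le> y l \<longleftrightarrow> c (Y i) l < c y l"
proof -
  have y: "y \<in> N" "gp.below Y y" using assms(2) unfolding gp.opt_def by auto
  have ik: "i \<in> {1..k}" "l \<in> {1..k}" using assms(3,4) by auto
  have "c (Y i) k < c y k" by (rule gp.combs_last_less[OF assms(1) y assms(3)])
  show ?thesis
  proof (cases "Y i \<in> N")
    case True
    then show ?thesis
      using perturb_less_iff[OF True y(1) ik(2)] perturb_last_less_iff[OF True y(1)] \<open>c (Y i) k < c y k\<close>
      by (auto simp: less_imp_le le_less)
  next
    case False
    then have "Y i = dummy k M i" using gp.combs_mem[OF assms(1,3)] by blast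
    then show ?thesis
      using gp.coord_d_other[OF ik] assms(5) gp.coord_gt[OF y(1) ik(2)] abs_bound[OF y(1) ik(2)] \<delta>_pos ik(2)
      unfolding dummy_def by auto
  qed
qed

text \<open>A perturbed feasible point exceeds all components of the combination in the lexicographic
  order, so the perturbation cannot make ties strict: both notions of feasibility agree.\<close>

lemma feasible_iff_below:
  assumes Y: "Y \<in> gp.combs" and z: "z \<in> N"
  shows "feasible k (viable_parameter k Y) z \<longleftrightarrow> gp.below Y z"
proof -
  have "z j < Y j j" if j: "j \<in> {1..k-1}" and b: "gp.below Y z" for j
  proof (cases "Y j \<in> N")
    case True
    have jk: "j \<in> {1..k}" using j by auto
    have "revlex_less k (Y j) z"
      using gp.combs_last_less[OF Y z b j] perturb_last_less_iff[OF True z] by blast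
    moreover have "c z j < c (Y j) j" using b j unfolding gp.below_def by blast
    ultimately show ?thesis using perturb_less_iff[OF z True jk] revlex_less_asym by blast
  next
    case False
    then have "Y j = dummy k M j" using gp.combs_mem[OF Y j] by blast
    then show ?thesis using abs_bound[OF z, of j] \<delta>_pos j unfolding dummy_def by auto
  qed
  moreover have "c z j < c (Y j) j" if j: "j \<in> {1..k-1}" and less: "z j < Y j j" for j
  proof (cases "Y j \<in> N")
    case True
    then show ?thesis using perturb_less[OF z True, of j] j less by auto
  next
    case False
    then have "Y j = dummy k M j" using gp.combs_mem[OF Y j] by blast
    then show ?thesis using gp.coord_lt[OF z, of j] gp.coord_d_same[of j] j by auto
  qed
  ultimately show ?thesis
    unfolding feasible_def vless_def viable_parameter_def gp.below_def by auto
qed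

lemma optimal_iff_opt:
  assumes Y: "Y \<in> gp.combs"
  shows "optimal k N (viable_parameter k Y) y \<longleftrightarrow> gp.opt Y y"
  unfolding optimal_iff[OF ext] gp.opt_def
  using feasible_iff_below[OF Y] perturb_last_less_iff by (metis not_le)

lemma is_scion_iff:
  assumes Y: "Y \<in> gp.combs" and l: "l \<in> {1..k-1}"
  shows "is_scion k N l Y Z \<longleftrightarrow>
    (\<exists>y. gp.opt Y y \<and> (\<forall>i\<in>{1..k-1} - {l}. c (Y i) l < c y l) \<and> Z = Y(l := y))"
  unfolding is_scion_def optimal_iff_opt[OF Y] using combs_coord_le_iff[OF Y _ _ l] by blast

text \<open>Coordinate \<open>k\<close> satisfies the weak inequality automatically, and so does the
  required difference: if \<open>Y i\<close> and \<open>y\<close> agreed after position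
  \<open>i\<close>, then \<open>y i < Y i i\<close> would make \<open>y\<close> precede
  \<open>Y i\<close>.\<close>

lemma vle_iff:
  assumes Y: "Y \<in> gp.combs" and y: "gp.opt Y y" and i: "i \<in> {1..k-1}"
  shows "vle {i+1..k} (Y i) y \<longleftrightarrow> (\<forall>j\<in>{i+1..k-1}. c (Y i) j < c y j)"
proof -
  have yN: "y \<in> N" "gp.below Y y" using y unfolding gp.opt_def by auto
  have ik: "i \<in> {1..k}" "k \<in> {i+1..k}" "k \<in> {1..k}" "k \<noteq> i" using i by auto
  have ins: "{i+1..k} = insert k {i+1..k-1}" using i by auto
  have le_iff: "Y i j \<le> y j \<longleftrightarrow> c (Y i) j < c y j" if "j \<in> {i+1..k-1}" for j
    by (rule combs_coord_le_iff[OF Y y i]) (use that in auto)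
  have last: "c (Y i) k < c y k" by (rule gp.combs_last_less[OF Y yN i])
  have "Y i k \<le> y k \<and> (\<exists>j\<in>{i+1..k}. Y i j \<noteq> y j)"
  proof (cases "Y i \<in> N")
    case True
    have rl: "revlex_less k (Y i) y" using last perturb_last_less_iff[OF True yN(1)] by blast
    have "y i < Y i i"
      using feasible_iff_below[OF Y yN(1)] yN(2) i
      unfolding feasible_def vless_def viable_parameter_def by auto
    then have "\<exists>j\<in>{i+1..k}. Y i j \<noteq> y j"
      using revlex_lessI[OF ik(1), of y "Y i"] revlex_less_asym[OF rl] by metis
    then show ?thesis using revlex_less_last_le[OF rl] by blast
  next
    case False
    then have "Y i = dummy k M i" using gp.combs_mem[OF Y i] by blast
    then have "Y i k = - M" using ik(3,4) unfolding dummy_def by auto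
    moreover have "- M < y k" using abs_bound[OF yN(1) ik(3)] \<delta>_pos by auto
    ultimately have "Y i k < y k" by simp
    then show ?thesis using ik(2) by force
  qed
  moreover have "(\<forall>j\<in>{i+1..k}. Y i j \<le> y j) \<longleftrightarrow> Y i k \<le> y k \<and> (\<forall>j\<in>{i+1..k-1}. Y i j \<le> y j)"
    unfolding ins by blast
  moreover have "(\<forall>j\<in>{i+1..k-1}. Y i j \<le> y j) \<longleftrightarrow> (\<forall>j\<in>{i+1..k-1}. c (Y i) j < c y j)"
    by (rule ball_cong[OF refl le_iff])
  ultimately show ?thesis unfolding vle_def by blast
qed

end

section \<open>Transfer to the integer problem\<close>

theorem theorem26:
  fixes k :: nat
  assumes "k \<ge> 2"
  shows
    "(\<forall>(n::nat) X f (\<delta>::real) (M::real) N.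
        integer_problem k n X f \<and> N = nondominated k (f ` X) \<and>
        admissible_constants k N \<delta> M \<longrightarrow>
        (\<forall>\<Z> \<in> true_combinations k \<delta> M N.
           \<Z> \<noteq> (\<lambda>t\<in>{1..k-1}. dummy k M t) \<longrightarrow>
           card {\<Y> \<in> true_combinations k \<delta> M N. \<exists>l\<in>{1..k-1}. is_scion k N l \<Y> \<Z>} = 1) \<and>
        (\<forall>y\<in>N. \<exists>!\<Y>. \<Y> \<in> true_combinations k \<delta> M N \<and>
           optimal k N (viable_parameter k \<Y>) y \<and>
           (\<forall>i\<in>{1..k-1}. vle {i+1..k} (\<Y> i) y))) \<and>
     (\<exists>C::real. \<forall>(n::nat) X f (\<delta>::real) (M::real) N.
        integer_problem k n X f \<and> N = nondominated k (f ` X) \<and> N \<noteq> {} \<and>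
        admissible_constants k N \<delta> M \<longrightarrow>
        real (card (true_combinations k \<delta> M N)) \<le> C * real (card N) ^ (k div 2))"
proof -
  have nd: "nondominated_set k N \<delta> M"
    if "integer_problem k n X f \<and> N = nondominated k (f ` X) \<and> admissible_constants k N \<delta> M"
    for n :: nat and X f \<delta> M N
  proof
    show "2 \<le> k" by (rule assms)
    show "finite N" "admissible_constants k N \<delta> M" using that unfolding integer_problem_def by auto
    show "N \<subseteq> extensional {1..k}"
      using that unfolding integer_problem_def nondominated_def by (auto simp: PiE_def)
    show "\<not> vle {1..k} x y" if "x \<in> N" "y \<in> N" for x y
      using that \<open>integer_problem k n X f \<and> N = nondominated k (f ` X) \<and> _\<close>
      unfolding nondominated_def by blast
  qed
  have i: "card {\<Y> \<in> true_combinations k \<delta> M N. \<exists>l\<in>{1..k-1}. is_scion k N l \<Y> \<Z>} = 1"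
    if "nondominated_set k N \<delta> M" "\<Z> \<in> true_combinations k \<delta> M N" "\<Z> \<noteq> (\<lambda>t\<in>{1..k-1}. dummy k M t)"
    for N \<delta> M \<Z>
  proof -
    interpret nondominated_set k N \<delta> M by (rule that)
    have "\<exists>!Y. Y \<in> gp.combs \<and> (\<exists>l\<in>{1..k-1}. is_scion k N l Y \<Z>)"
      using gp.ex1_parent[OF _ that(3)] that(2) is_scion_iff unfolding true_combinations_eq
      by (metis (no_types, lifting))
    then show ?thesis
      unfolding true_combinations_eq by (auto simp: card_1_singleton_iff)
  qed
  have ii: "\<exists>!\<Y>. \<Y> \<in> true_combinations k \<delta> M N \<and> optimal k N (viable_parameter k \<Y>) y \<and>
           (\<forall>i\<in>{1..k-1}. vle {i+1..k} (\<Y> i) y)"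
    if "nondominated_set k N \<delta> M" "y \<in> N" for N \<delta> M y
  proof -
    interpret nondominated_set k N \<delta> M by (rule that)
    have "\<Y> \<in> gp.combs \<and> optimal k N (viable_parameter k \<Y>) y \<and> (\<forall>i\<in>{1..k-1}. vle {i+1..k} (\<Y> i) y) \<longleftrightarrow>
      \<Y> \<in> gp.combs \<and> gp.opt \<Y> y \<and> (\<forall>i\<in>{1..k-1}. \<forall>j\<in>{i+1..k-1}. c (\<Y> i) j < c y j)" for \<Y>
      using optimal_iff_opt vle_iff by blast
    then show ?thesis
      using gp.ex1_leading_comb[OF that(2)] unfolding true_combinations_eq by simp
  qed
  have iii: "real (card (true_combinations k \<delta> M N)) \<le> real (k ^ k * 2 ^ k * 2 ^ (k div 2)) * real (card N) ^ (k div 2)"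
    if "nondominated_set k N \<delta> M" "N \<noteq> {}" for N \<delta> M
  proof -
    interpret nondominated_set k N \<delta> M by (rule that)
    \<comment> \<open>Nonemptiness of \<open>N\<close> absorbs the dummy into a factor 2 per
      position, so the constant depends on \<open>k\<close> alone.\<close>
    have "card N + 1 \<le> 2 * card N" using that(2) finite_N by (simp add: Suc_le_eq card_gt_0_iff)
    then have "(card N + 1) ^ (k div 2) \<le> 2 ^ (k div 2) * card N ^ (k div 2)"
      by (metis power_mono power_mult_distrib le0)
    then have "card gp.combs \<le> k ^ k * 2 ^ k * (2 ^ (k div 2) * card N ^ (k div 2))"
      using gp.card_combs_le by (meson le_trans mult_le_mono2)
    then have "real (card gp.combs) \<le> real (k ^ k * 2 ^ k * (2 ^ (k div 2) * card N ^ (k div 2)))"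
      by (rule of_nat_mono)
    then show ?thesis unfolding true_combinations_eq by (simp add: mult.assoc)
  qed
  show ?thesis
  proof (rule conjI, intro allI impI)
    fix n :: nat and X f and \<delta> M :: real and N
    assume "integer_problem k n X f \<and> N = nondominated k (f ` X) \<and> admissible_constants k N \<delta> M"
    then have S: "nondominated_set k N \<delta> M" by (rule nd)
    show "(\<forall>\<Z> \<in> true_combinations k \<delta> M N.
           \<Z> \<noteq> (\<lambda>t\<in>{1..k-1}. dummy k M t) \<longrightarrow>
           card {\<Y> \<in> true_combinations k \<delta> M N. \<exists>l\<in>{1..k-1}. is_scion k N l \<Y> \<Z>} = 1) \<and>
        (\<forall>y\<in>N. \<exists>!\<Y>. \<Y> \<in> true_combinations k \<delta> M N \<and>
           optimal k N (viable_parameter k \<Y>) y \<and>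
           (\<forall>i\<in>{1..k-1}. vle {i+1..k} (\<Y> i) y))"
      by (intro conjI ballI impI i[OF S] ii[OF S])
  next
    show "\<exists>C::real. \<forall>(n::nat) X f (\<delta>::real) (M::real) N.
        integer_problem k n X f \<and> N = nondominated k (f ` X) \<and> N \<noteq> {} \<and>
        admissible_constants k N \<delta> M \<longrightarrow>
        real (card (true_combinations k \<delta> M N)) \<le> C * real (card N) ^ (k div 2)"
    proof (intro exI allI impI)
      fix n :: nat and X f and \<delta> M :: real and N
      assume a: "integer_problem k n X f \<and> N = nondominated k (f ` X) \<and> N \<noteq> {} \<and>
        admissible_constants k N \<delta> M"
      then have "integer_problem k n X f \<and> N = nondominated k (f ` X) \<and> admissible_constants k N \<delta> M"
        by (elim conjE) (intro conjI)
      then have S: "nondominated_set k N \<delta> M" by (rule nd)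
      show "real (card (true_combinations k \<delta> M N))
          \<le> real (k ^ k * 2 ^ k * 2 ^ (k div 2)) * real (card N) ^ (k div 2)"
        by (rule iii[OF S]) (use a in blast)
    qed
  qed
qed

end
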